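(* Let $\Sigma_N(\mathfrak A,\mathfrak B,\mathfrak C)$ be an NBCO-system on Hilbert spaces $(X,U,Y)$ with main operators $A(t)$ having a common extrapolation space $X_{-1}$, generated evolution family $\mathcal U$, and control operators $B(t)\in\mathcal L(U,X_{-1})$, $t\ge0$. Assume that $\mathcal A^*:=\{A^*(t)\mid t\ge0\}$ belongs to the Kato class and that $\{B(t)\mid t\ge0\}$ is $L^2$-admissible for $\mathcal U$. Then for each $s\ge 0$ and each $(x_s,u)\in X\times L^2_{loc}([0,\infty);U)$ with $B(\cdot)u(\cdot)\in L^1_{loc}([0,\infty);X_{-1})$, the system $$\dot x(t)=\mathfrak A(t)x(t),\ x(s)=x_s,\qquad \mathfrak B(t)x(t)=u(t),\qquad \mathfrak C(t)x(t)=y(t),\qquad t\ge s,$$ has a unique mild solution in $X$.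
   Context: Extrapolation space: for a generator $A$ on $X$, $X_{-1}$ is the completion of $X$ for the norm $\|(\beta I-A)^{-1}x\|$, $\beta\in\rho(A)$, and $A_{-1}:X\to X_{-1}$ is the continuous extension of $A$. Common extrapolation space means $X_{-1}(t)=X_{-1}(s)=:X_{-1}$ for all $t,s\ge0$; equivalently, the domains $D(A^*(t))$ coincide for all $t$, with locally uniformly equivalent graph norms. Kato class: a family $\{G(t)\}_{t\ge0}$ of operators on $X$ is Kato-stable if for each $t\ge0$ there is a norm $\|\cdot\|_t$ on $X$ equivalent to the original one such that for each $T\ge0$ there is $c_T\ge0$ with $|\|x\|_t-\|x\|_s|\le c_T|t-s|\|x\|_s$ for $x\in X$, $t,s\in[0,T]$, and $G(t)$ generates a contractive $C_0$-semigroup on $(X,\|\cdot\|_t)$ for all $t\ge0$. It belongs to the Kato class if it is Kato-stable, the $G(t)$ have a common domain $D$, and $G(\cdot):[0,\infty)\to\mathcal L(D,X)$ is strongly $C^1$. Evolution family on $X$: a family $\{U(t,s)\mid t\ge s\ge0\}\subset\mathcal L(X)$, strongly continuous, with $U(t,t)=I$, $U(t,s)=U(t,r)U(r,s)$ for $0\le s\le r\le t$. It is generated by closed operators $\{A(t)\}$ if there are dense subspaces $Y_t\subset D(A(t))$ such that for $s\ge 0$, $x_s\in Y_s$, $t\mapsto U(t,s)x_s$ is the unique classical solution of $\dot w=A(t)w$ on $[s,\infty)$, $w(s)=x_s$ (continuous on $[s,\infty)$, $C^1$ on $(s,\infty)$, $w(t)\in D(A(t))$ for $t\ge s$). BCO-system: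 linear operators $\mathfrak A:D(\mathfrak A)\subset X\to X$, $\mathfrak B:D(\mathfrak B)\to U$, $\mathfrak C:D(\mathfrak A)\to Y$ with $D(\mathfrak A)\subset D(\mathfrak B)$ such that (i) the main operator $A:=\mathfrak A|_{D(\mathfrak A)\cap\ker\mathfrak B}$ generates a $C_0$-semigroup; (ii) there is $\tilde B\in\mathcal L(U,X)$ with $\tilde BU\subset D(\mathfrak A)$, $\mathfrak A\tilde B\in\mathcal L(U,X)$, $\mathfrak B\tilde B=I_U$; (iii) $\mathfrak C$ is bounded from $D(\mathfrak A)$ (graph norm) to $Y$. NBCO-system: a family $(\mathfrak A(t),\mathfrak B(t),\mathfrak C(t))$, $t\ge0$, of BCO-systems whose main operators $\{A(t)\}$ generate an evolution family. The control operators are $B(t):=\mathfrak A(t)\tilde B(t)-A_{-1}(t)\tilde B(t)$. Mild solution: suppose each $U(t,s)$ has a unique extension $U_{-1}(t,s)\in\mathcal L(X_{-1})$ and $r\mapsto U_{-1}(t,r)B(r)u(r)$ is (locally) integrable with values in $X_{-1}$. Then $x(t)=U(t,s)x_s+\int_s^tU_{-1}(t,r)B(r)u(r)\,dr$, $t\ge s$, is the mild solution in $X_{-1}$; it is a mild solution in $X$ if in addition $\int_{s}^{t}U_{-1}(t,r)B(r)u(r)\,dr\in X$ for all $t\ge s\ge 0$ and $x\in C([s,\infty);X)$. $L^2$-admissible: $\{B(t)\}\subset\mathcal L(U,X_{-1})$ is $L^2$-admissible for an evolution family $\mathcal U$ admitting an extension $U_{-1}(t,s)\in\mathcal L(X_{-1})$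 if for each $u\in L^2_{loc}([0,\infty);U)$ the function $U_{-1}(t,\cdot)B(\cdot)u(\cdot)$ is locally integrable in $X_{-1}$, $\int_s^tU_{-1}(t,r)B(r)u(r)\,dr\in X$ for all $t\ge s\ge0$, and for each $T>0$ there is $c_T>0$ with $\big\|\int_s^tU_{-1}(t,r)B(r)u(r)\,dr\big\|_X^2\le c_T\int_s^t\|u(r)\|_U^2dr$ for all $0\le s\le t\le T$. *)

theory Defs
  imports "HOL-Analysis.Analysis"
begin

text \<open>
  Conventions.  Hilbert spaces are types of sort \<open>{real_inner, banach}\<close>.  The scalar field
  is the reals; a complex Hilbert space is included through its underlying real Hilbert space
  with inner product \<open>Re \<langle>x, y\<rangle>\<close>: generators, adjoints, bounded
  extensions, integrals and (up to equivalence of norms) the extrapolation spaces are the same over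
  either field.

  An unbounded operator \<open>A : D(A) \<subseteq> X \<rightarrow> Y\<close> is its graph, a set of
  pairs; \<open>D(A)\<close> is \<open>Domain A\<close>, and \<open>A\<close> is a closed operator
  iff its graph is \<open>closed\<close>.  Time is real; families indexed by time are only ever used at
  times \<open>\<ge> 0\<close>, and two-parameter families \<open>U t s\<close> only for
  \<open>0 \<le> s \<le> t\<close>.
\<close>

section \<open>Unbounded operators\<close>

definition linear_operator :: "('a::real_vector \<times> 'b::real_vector) set \<Rightarrow> bool" where
  "linear_operator A \<longleftrightarrow> subspace A \<and> single_valued A"

definition op_app :: "('a \<times> 'b) set \<Rightarrow> 'a \<Rightarrow> 'b" where
  "op_app A x = (THE y. (x, y) \<in> A)"

text \<open>A genuine (single-valued) operator whenever \<open>A\<close> is densely defined.\<close>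

definition op_adjoint :: "('x::real_inner \<times> 'x) set \<Rightarrow> ('x \<times> 'x) set" where
  "op_adjoint A = {(y, z). \<forall>(x, w)\<in>A. inner w y = inner x z}"

definition is_resolvent ::
  "('x::real_normed_vector \<times> 'x) set \<Rightarrow> real \<Rightarrow> ('x \<Rightarrow> 'x) \<Rightarrow> bool" where
  "is_resolvent A \<beta> R \<longleftrightarrow> bounded_linear R \<and>
     (\<forall>x. (R x, \<beta> *\<^sub>R R x - x) \<in> A) \<and>
     (\<forall>(x, y)\<in>A. R (\<beta> *\<^sub>R x - y) = x)"


section \<open>Semigroups, Kato class, evolution families\<close>

definition C0_semigroup :: "(real \<Rightarrow> 'x::real_normed_vector \<Rightarrow> 'x) \<Rightarrow> bool" where
  "C0_semigroup S \<longleftrightarrow>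
     (\<forall>t\<ge>0. bounded_linear (S t)) \<and>
     (\<forall>x. S 0 x = x) \<and>
     (\<forall>t\<ge>0. \<forall>s\<ge>0. \<forall>x. S (t + s) x = S t (S s x)) \<and>
     (\<forall>x. continuous_on {0..} (\<lambda>t. S t x))"

definition generator ::
  "(real \<Rightarrow> 'x::real_normed_vector \<Rightarrow> 'x) \<Rightarrow> ('x \<times> 'x) set" where
  "generator S = {(x, y). ((\<lambda>h. (S h x - x) /\<^sub>R h) \<longlongrightarrow> y) (at_right 0)}"

definition generates_C0_semigroup :: "('x::real_normed_vector \<times> 'x) set \<Rightarrow> bool" where
  "generates_C0_semigroup A \<longleftrightarrow> (\<exists>S. C0_semigroup S \<and> A = generator S)"

definition equivalent_norm :: "('x::real_normed_vector \<Rightarrow> real) \<Rightarrow> bool" where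
  "equivalent_norm N \<longleftrightarrow>
     (\<forall>x y. N (x + y) \<le> N x + N y) \<and>
     (\<forall>a x. N (a *\<^sub>R x) = \<bar>a\<bar> * N x) \<and>
     (\<exists>c>0. \<exists>C>0. \<forall>x. c * norm x \<le> N x \<and> N x \<le> C * norm x)"

text \<open>Strong continuity and the generator do not change under an equivalent norm, so only
  contractivity mentions \<open>N\<close>.\<close>

definition generates_contractive_C0_semigroup ::
  "('x::real_normed_vector \<Rightarrow> real) \<Rightarrow> ('x \<times> 'x) set \<Rightarrow> bool" where
  "generates_contractive_C0_semigroup N A \<longleftrightarrow>
     (\<exists>S. C0_semigroup S \<and> A = generator S \<and> (\<forall>t\<ge>0. \<forall>x. N (S t x) \<le> N x))"

definition kato_stable :: "(real \<Rightarrow> ('x::real_normed_vector \<times> 'x) set) \<Rightarrow> bool" where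
  "kato_stable G \<longleftrightarrow>
     (\<exists>N. (\<forall>t\<ge>0. equivalent_norm (N t)) \<and>
          (\<forall>T\<ge>0. \<exists>c\<ge>0. \<forall>x. \<forall>t\<in>{0..T}. \<forall>s\<in>{0..T}.
              \<bar>N t x - N s x\<bar> \<le> c * \<bar>t - s\<bar> * N s x) \<and>
          (\<forall>t\<ge>0. generates_contractive_C0_semigroup (N t) (G t)))"

text \<open>In the third conjunct the common domain carries any one of the graph norms (they are all
  equivalent); it says that every \<open>G t\<close> lies in \<open>L(D, X)\<close>.\<close>

definition kato_class :: "(real \<Rightarrow> ('x::real_normed_vector \<times> 'x) set) \<Rightarrow> bool" where
  "kato_class G \<longleftrightarrow> kato_stable G \<and>
     (\<exists>D. (\<forall>t\<ge>0. Domain (G t) = D) \<and>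
          (\<forall>t\<ge>0. \<forall>s\<ge>0. \<exists>c. \<forall>x\<in>D.
              norm (op_app (G t) x) \<le> c * (norm x + norm (op_app (G s) x))) \<and>
          (\<forall>x\<in>D. \<exists>g'. continuous_on {0..} g' \<and>
              (\<forall>t\<ge>0. ((\<lambda>t. op_app (G t) x) has_vector_derivative g' t)
                 (at t within {0..}))))"

definition evolution_family ::
  "(real \<Rightarrow> real \<Rightarrow> 'x::real_normed_vector \<Rightarrow> 'x) \<Rightarrow> bool" where
  "evolution_family U \<longleftrightarrow>
     (\<forall>t s. 0 \<le> s \<and> s \<le> t \<longrightarrow> bounded_linear (U t s)) \<and>
     (\<forall>x. continuous_on {(t, s). 0 \<le> s \<and> s \<le> t} (\<lambda>(t, s). U t s x)) \<and>
     (\<forall>t\<ge>0. \<forall>x. U t t x = x) \<and>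
     (\<forall>t r s x. 0 \<le> s \<and> s \<le> r \<and> r \<le> t \<longrightarrow> U t s x = U t r (U r s x))"

text \<open>The differential equation is required on the open interval, where \<open>w\<close> is
  \<open>C\<^sup>1\<close>.\<close>

definition classical_solution ::
  "(real \<Rightarrow> ('x::real_normed_vector \<times> 'x) set) \<Rightarrow> real \<Rightarrow> 'x \<Rightarrow> (real \<Rightarrow> 'x) \<Rightarrow> bool" where
  "classical_solution A s xs w \<longleftrightarrow>
     continuous_on {s..} w \<and> w s = xs \<and> (\<forall>t\<ge>s. w t \<in> Domain (A t)) \<and>
     (\<exists>w'. continuous_on {s<..} w' \<and>
        (\<forall>t>s. (w has_vector_derivative w' t) (at t) \<and> (w t, w' t) \<in> A t))"

definition generates_evolution_family ::
  "(real \<Rightarrow> ('x::real_normed_vector \<times> 'x) set) \<Rightarrow> (real \<Rightarrow> real \<Rightarrow> 'x \<Rightarrow> 'x) \<Rightarrow> bool" where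
  "generates_evolution_family A U \<longleftrightarrow> evolution_family U \<and>
     (\<forall>t\<ge>0. linear_operator (A t) \<and> closed (A t)) \<and>
     (\<exists>Y. (\<forall>t\<ge>0. subspace (Y t) \<and> closure (Y t) = UNIV \<and> Y t \<subseteq> Domain (A t)) \<and>
          (\<forall>s\<ge>0. \<forall>xs\<in>Y s. classical_solution A s xs (\<lambda>t. U t s xs) \<and>
             (\<forall>w. classical_solution A s xs w \<longrightarrow> (\<forall>t\<ge>s. w t = U t s xs))))"


section \<open>BCO-systems and NBCO-systems\<close>

text \<open>The restriction of \<open>\<AA>\<close> to
  \<open>D(\<AA>) \<inter> ker \<BB>\<close>.\<close>

definition main_operator ::
  "('x \<times> 'x) set \<Rightarrow> ('x \<times> 'u::zero) set \<Rightarrow> ('x \<times> 'x) set" where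
  "main_operator \<AA> \<BB> = {(x, y). (x, y) \<in> \<AA> \<and> (x, 0) \<in> \<BB>}"

text \<open>\<open>Bt\<close> is a bounded right inverse of \<open>\<BB>\<close> with range in
  \<open>D(\<AA>)\<close>, and \<open>C\<close> is the bounded operator \<open>\<AA> Bt\<close>.\<close>

definition boundary_lift ::
  "('x::real_normed_vector \<times> 'x) set \<Rightarrow> ('x \<times> 'u::real_normed_vector) set \<Rightarrow>
   ('u \<Rightarrow> 'x) \<Rightarrow> ('u \<Rightarrow> 'x) \<Rightarrow> bool" where
  "boundary_lift \<AA> \<BB> Bt C \<longleftrightarrow> bounded_linear Bt \<and> bounded_linear C \<and>
     (\<forall>v. (Bt v, C v) \<in> \<AA> \<and> (Bt v, v) \<in> \<BB>)"

definition bco_system ::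
  "('x::real_normed_vector \<times> 'x) set \<Rightarrow> ('x \<times> 'u::real_normed_vector) set \<Rightarrow>
   ('x \<times> 'y::real_normed_vector) set \<Rightarrow> bool" where
  "bco_system \<AA> \<BB> \<CC> \<longleftrightarrow>
     linear_operator \<AA> \<and> linear_operator \<BB> \<and> linear_operator \<CC> \<and>
     Domain \<AA> \<subseteq> Domain \<BB> \<and> Domain \<CC> = Domain \<AA> \<and>
     generates_C0_semigroup (main_operator \<AA> \<BB>) \<and>
     (\<exists>Bt C. boundary_lift \<AA> \<BB> Bt C) \<and>
     (\<exists>c. \<forall>x z y. (x, z) \<in> \<AA> \<and> (x, y) \<in> \<CC> \<longrightarrow> norm y \<le> c * (norm x + norm z))"

definition nbco_system ::
  "(real \<Rightarrow> ('x::real_normed_vector \<times> 'x) set) \<Rightarrow>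
   (real \<Rightarrow> ('x \<times> 'u::real_normed_vector) set) \<Rightarrow>
   (real \<Rightarrow> ('x \<times> 'y::real_normed_vector) set) \<Rightarrow> bool" where
  "nbco_system \<AA> \<BB> \<CC> \<longleftrightarrow>
     (\<forall>t\<ge>0. bco_system (\<AA> t) (\<BB> t) (\<CC> t)) \<and>
     (\<exists>U. generates_evolution_family (\<lambda>t. main_operator (\<AA> t) (\<BB> t)) U)"


section \<open>Extrapolation\<close>

text \<open>
  A completion is determined only up to isomorphism, so the extrapolation space is represented by a
  Banach space \<open>'e\<close> together with an embedding \<open>\<iota>\<close> of \<open>X\<close>
  as a dense subspace.  The norm is fixed only up to equivalence, which makes the choice of
  \<open>\<beta>\<close> immaterial and allows one space to serve several operators.
\<close>

definition extrapolation_space ::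
  "('x::real_normed_vector \<Rightarrow> 'e::banach) \<Rightarrow> ('x \<times> 'x) set \<Rightarrow> bool" where
  "extrapolation_space \<iota> A \<longleftrightarrow> linear \<iota> \<and> closure (range \<iota>) = UNIV \<and>
     (\<exists>\<beta> R. is_resolvent A \<beta> R \<and>
        (\<exists>c>0. \<exists>C>0. \<forall>x. c * norm (R x) \<le> norm (\<iota> x) \<and> norm (\<iota> x) \<le> C * norm (R x)))"

text \<open>
  \<open>X\<^sub>-\<^sub>1(t) = X\<^sub>-\<^sub>1(s)\<close> as completions of \<open>X\<close>: one pair
  \<open>('e, \<iota>)\<close> works for every \<open>t\<close>.  Local uniformity in \<open>t\<close>
  of the norm equivalences is not demanded; it is automatic if the adjoints form a Kato class.
\<close>

definition common_extrapolation_space ::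
  "('x::real_normed_vector \<Rightarrow> 'e::banach) \<Rightarrow> (real \<Rightarrow> ('x \<times> 'x) set) \<Rightarrow> bool" where
  "common_extrapolation_space \<iota> A \<longleftrightarrow> (\<forall>t\<ge>0. extrapolation_space \<iota> (A t))"

definition extrapolated_operator ::
  "('x::real_normed_vector \<Rightarrow> 'e::real_normed_vector) \<Rightarrow> ('x \<times> 'x) set \<Rightarrow> ('x \<Rightarrow> 'e) \<Rightarrow> bool" where
  "extrapolated_operator \<iota> A A1 \<longleftrightarrow> bounded_linear A1 \<and> (\<forall>(x, y)\<in>A. A1 x = \<iota> y)"

text \<open>\<open>B = \<AA> Bt - A\<^sub>-\<^sub>1 Bt\<close>.  Two choices of \<open>Bt\<close> differ
  by a map into the domain of the main operator, where \<open>\<AA>\<close> and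
  \<open>A\<^sub>-\<^sub>1\<close> agree, so \<open>B\<close> is uniquely determined.\<close>

definition is_control_operator ::
  "('x::real_normed_vector \<Rightarrow> 'e::real_normed_vector) \<Rightarrow> ('x \<times> 'x) set \<Rightarrow>
   ('x \<times> 'u::real_normed_vector) set \<Rightarrow> ('u \<Rightarrow> 'e) \<Rightarrow> bool" where
  "is_control_operator \<iota> \<AA> \<BB> B \<longleftrightarrow>
     (\<exists>Bt C A1. boundary_lift \<AA> \<BB> Bt C \<and>
        extrapolated_operator \<iota> (main_operator \<AA> \<BB>) A1 \<and>
        (\<forall>v. B v = \<iota> (C v) - A1 (Bt v)))"

definition is_extension ::
  "('x \<Rightarrow> 'e::real_normed_vector) \<Rightarrow> ('x \<Rightarrow> 'x) \<Rightarrow> ('e \<Rightarrow> 'e) \<Rightarrow> bool" where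
  "is_extension \<iota> V V1 \<longleftrightarrow> bounded_linear V1 \<and> (\<forall>x. V1 (\<iota> x) = \<iota> (V x))"

text \<open>\<open>extension \<iota> (U t s)\<close> is \<open>U\<^sub>-\<^sub>1(t, s)\<close>; it is
  meaningful only if a unique extension exists.\<close>

definition extension ::
  "('x \<Rightarrow> 'e::real_normed_vector) \<Rightarrow> ('x \<Rightarrow> 'x) \<Rightarrow> 'e \<Rightarrow> 'e" where
  "extension \<iota> V = (THE V1. is_extension \<iota> V V1)"


section \<open>Vector-valued integration\<close>

text \<open>
  The library's Bochner integral is restricted to second countable spaces.  To cover non-separable
  spaces, Bochner integrability is defined directly (strong measurability and integrable norm);
  the value of the integral is written with the Henstock--Kurzweil \<open>integral\<close>, which
  agrees with the Bochner integral for Bochner integrable functions into any Banach space.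
\<close>

definition strongly_measurable_on :: "real set \<Rightarrow> (real \<Rightarrow> 'b::real_normed_vector) \<Rightarrow> bool" where
  "strongly_measurable_on S f \<longleftrightarrow>
     (\<exists>\<phi>. (\<forall>n::nat. simple_function lebesgue (\<phi> n)) \<and>
          (AE r in lebesgue. r \<in> S \<longrightarrow> (\<lambda>n. \<phi> n r) \<longlonglongrightarrow> f r))"

definition bochner_integrable_on :: "(real \<Rightarrow> 'b::real_normed_vector) \<Rightarrow> real set \<Rightarrow> bool" where
  "bochner_integrable_on f S \<longleftrightarrow> strongly_measurable_on S f \<and>
     (\<lambda>r. norm (f r)) absolutely_integrable_on S"

definition L1_loc :: "(real \<Rightarrow> 'b::real_normed_vector) \<Rightarrow> bool" where
  "L1_loc f \<longleftrightarrow> (\<forall>T\<ge>0. bochner_integrable_on f {0..T})"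

definition L2_loc :: "(real \<Rightarrow> 'b::real_normed_vector) \<Rightarrow> bool" where
  "L2_loc f \<longleftrightarrow> (\<forall>T\<ge>0. strongly_measurable_on {0..T} f \<and>
     (\<lambda>r. (norm (f r))\<^sup>2) absolutely_integrable_on {0..T})"


section \<open>Mild solutions and admissibility\<close>

text \<open>The integral of \<open>U\<^sub>-\<^sub>1(t, r) B(r) u(r)\<close> over
  \<open>[s, t]\<close>, an element of the extrapolation space.\<close>

definition input_term ::
  "('x \<Rightarrow> 'e::banach) \<Rightarrow> (real \<Rightarrow> real \<Rightarrow> 'x \<Rightarrow> 'x) \<Rightarrow> (real \<Rightarrow> 'u \<Rightarrow> 'e) \<Rightarrow> (real \<Rightarrow> 'u) \<Rightarrow>
   real \<Rightarrow> real \<Rightarrow> 'e" where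
  "input_term \<iota> U B u t s = integral {s..t} (\<lambda>r. extension \<iota> (U t r) (B r (u r)))"

text \<open>
  The existence of the extensions \<open>U\<^sub>-\<^sub>1(t, s)\<close>, without which this notion is not
  meaningful, is deliberately not part of the predicate: it is part of what
  \<open>mild_solution_extrapolated\<close> asserts.
\<close>

definition L2_admissible ::
  "('x::real_normed_vector \<Rightarrow> 'e::banach) \<Rightarrow> (real \<Rightarrow> real \<Rightarrow> 'x \<Rightarrow> 'x) \<Rightarrow>
   (real \<Rightarrow> 'u::real_normed_vector \<Rightarrow> 'e) \<Rightarrow> bool" where
  "L2_admissible \<iota> U B \<longleftrightarrow>
     (\<forall>t\<ge>0. bounded_linear (B t)) \<and>
     (\<forall>u. L2_loc u \<longrightarrow>
        (\<forall>t\<ge>0. bochner_integrable_on (\<lambda>r. extension \<iota> (U t r) (B r (u r))) {0..t}) \<and>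
        (\<forall>s t. 0 \<le> s \<and> s \<le> t \<longrightarrow> input_term \<iota> U B u t s \<in> range \<iota>)) \<and>
     (\<forall>T>0. \<exists>c>0. \<forall>u. L2_loc u \<longrightarrow>
        (\<forall>s t z. 0 \<le> s \<and> s \<le> t \<and> t \<le> T \<and> \<iota> z = input_term \<iota> U B u t s \<longrightarrow>
           (norm z)\<^sup>2 \<le> c * integral {s..t} (\<lambda>r. (norm (u r))\<^sup>2)))"

definition mild_solution_extrapolated ::
  "('x \<Rightarrow> 'e::banach) \<Rightarrow> (real \<Rightarrow> real \<Rightarrow> 'x \<Rightarrow> 'x) \<Rightarrow> (real \<Rightarrow> 'u \<Rightarrow> 'e) \<Rightarrow>
   real \<Rightarrow> 'x \<Rightarrow> (real \<Rightarrow> 'u) \<Rightarrow> (real \<Rightarrow> 'e) \<Rightarrow> bool" where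
  "mild_solution_extrapolated \<iota> U B s xs u w \<longleftrightarrow>
     (\<forall>r t. 0 \<le> r \<and> r \<le> t \<longrightarrow> (\<exists>!V1. is_extension \<iota> (U t r) V1)) \<and>
     (\<forall>t\<ge>0. bochner_integrable_on (\<lambda>r. extension \<iota> (U t r) (B r (u r))) {0..t}) \<and>
     (\<forall>t\<ge>s. w t = \<iota> (U t s xs) + input_term \<iota> U B u t s)"

definition mild_solution ::
  "('x::topological_space \<Rightarrow> 'e::banach) \<Rightarrow> (real \<Rightarrow> real \<Rightarrow> 'x \<Rightarrow> 'x) \<Rightarrow>
   (real \<Rightarrow> 'u \<Rightarrow> 'e) \<Rightarrow> real \<Rightarrow> 'x \<Rightarrow> (real \<Rightarrow> 'u) \<Rightarrow> (real \<Rightarrow> 'x) \<Rightarrow> bool" where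
  "mild_solution \<iota> U B s xs u x \<longleftrightarrow>
     mild_solution_extrapolated \<iota> U B s xs u (\<lambda>t. \<iota> (x t)) \<and>
     (\<forall>r t. 0 \<le> r \<and> r \<le> t \<longrightarrow> input_term \<iota> U B u t r \<in> range \<iota>) \<and>
     continuous_on {s..} x"

end

theory Submission
  imports Defs
begin

text \<open>
  The norm of \<open>X\<^sub>-\<^sub>1\<close> is dual to the graph norm of \<open>A(t)\<^sup>*\<close>, so \<open>U(t, s)\<close> extends to
  \<open>X\<^sub>-\<^sub>1\<close> as soon as \<open>\<bar>\<langle>U(t, s)x, y\<rangle>\<bar> \<le> C \<parallel>\<iota> x\<parallel> \<parallel>y\<parallel>\<close>, with the graph norm of \<open>y\<close>.  To get
  this bound, freeze \<open>A(\<cdot>)\<^sup>*\<close> on a grid in \<open>[s, t]\<close> of mesh \<open>h\<close> and transport \<open>y\<close> backwards with the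
  contraction semigroups generated by the frozen operators: Kato stability together with the Lipschitz
  dependence of \<open>A(\<cdot>)\<^sup>*\<close> on time keeps the graph norms of the transported vectors uniformly
  bounded, and pairing with the classical solution \<open>U(\<cdot>, s)x\<close> changes by only \<open>O(h\<^sup>2)\<close> per
  step.  Only this weak form of the backward evolution equation is needed, and no construction of
  its evolution family.

  The input term \<open>z\<close> then satisfies \<open>z(t) = U(t, p)z(p) + q\<close>, where admissibility bounds
  \<open>\<parallel>q\<parallel>\<^sup>2\<close> by a multiple of \<open>\<integral>\<^sub>p\<^sup>t \<parallel>u\<parallel>\<^sup>2\<close>.  Near each time \<open>z\<close> is therefore uniformly close to the
  continuous function \<open>U(\<cdot>, p)z(p)\<close> for a suitable \<open>p\<close>.
\<close>

section \<open>Duality and uniform boundedness\<close>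

text \<open>The representing vector minimises \<open>J x = (norm x)^2 - 2 f x\<close>. The
  parallelogram identity, with the midpoint tested against the infimum, makes a minimising sequence
  Cauchy; at its limit the variation of \<open>J\<close> in every direction gives the
  formula.\<close>

lemma riesz_representation:
  fixes f :: "'a::{real_inner, banach} \<Rightarrow> real"
  assumes "bounded_linear f"
  obtains y where "\<And>x. f x = inner x y"
proof -
  interpret f: bounded_linear f by fact
  define J where "J x = (norm x)\<^sup>2 - 2 * f x" for x
  obtain K where K: "\<And>x. norm (f x) \<le> norm x * K"
    using f.bounded by blast
  have "- K\<^sup>2 \<le> J x" for x
  proof -
    have "0 \<le> (norm x - K)\<^sup>2" by simp
    then show ?thesis
      using K[of x] unfolding J_def by (simp add: power2_diff)
  qed
  then have bdd: "bdd_below (range J)"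
    by (meson bdd_belowI2)
  define m where "m = (INF x. J x)"
  have m_le: "m \<le> J x" for x
    unfolding m_def using bdd by (simp add: cINF_lower)
  have "\<exists>x. J x < m + 1 / real (Suc n)" for n
    using cINF_less_iff[OF _ bdd, of "m + 1 / real (Suc n)"] unfolding m_def by auto
  then obtain X where X: "\<And>n. J (X n) < m + 1 / real (Suc n)"
    by metis
  have parallelogram: "(norm (x - y))\<^sup>2 \<le> 2 * (J x - m) + 2 * (J y - m)" for x y
  proof -
    have "(norm (x - y))\<^sup>2 = 2 * J x + 2 * J y - 4 * J ((1/2) *\<^sub>R (x + y))"
      unfolding J_def f.scaleR f.add
      by (simp add: power2_norm_eq_inner inner_diff inner_add inner_commute algebra_simps)
    then show ?thesis using m_le[of "(1/2) *\<^sub>R (x + y)"] by simp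
  qed
  have "Cauchy X"
    unfolding Cauchy_def
  proof (intro allI impI)
    fix e :: real assume "e > 0"
    then obtain M where M: "inverse (real (Suc M)) < e\<^sup>2 / 4"
      using reals_Archimedean[of "e\<^sup>2 / 4"] by auto
    have "dist (X j) (X k) < e" if "j \<ge> M" "k \<ge> M" for j k
    proof -
      have "J (X i) - m < e\<^sup>2 / 4" if "i \<ge> M" for i
      proof -
        have "1 / real (Suc i) \<le> inverse (real (Suc M))"
          using that by (simp add: field_simps)
        then show ?thesis using X[of i] M by linarith
      qed
      from this[OF that(1)] this[OF that(2)] have "(norm (X j - X k))\<^sup>2 < e\<^sup>2"
        using parallelogram[of "X j" "X k"] by argo
      then show ?thesis
        using \<open>e > 0\<close> by (simp add: dist_norm power_less_imp_less_base)
    qed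
    then show "\<exists>M. \<forall>j\<ge>M. \<forall>k\<ge>M. dist (X j) (X k) < e" by blast
  qed
  then obtain y where y: "X \<longlonglongrightarrow> y"
    using Cauchy_convergent convergent_def by blast
  have lim_J: "(\<lambda>n. J (X n)) \<longlonglongrightarrow> J y"
    unfolding J_def by (intro tendsto_intros f.tendsto y)
  have lim_m: "(\<lambda>n. m + 1 / real (Suc n)) \<longlonglongrightarrow> m + 0"
    by (intro tendsto_intros LIMSEQ_Suc lim_1_over_n)
  have "J y \<le> m + 0"
    by (rule LIMSEQ_le[OF lim_J lim_m]) (use X less_imp_le in blast)
  then have min: "J y \<le> J x" for x
    using m_le[of x] by linarith
  have "f x = inner x y" for x
  proof (cases "x = 0")
    case False
    define d where "d = f x - inner x y"
    \<comment> \<open>The minimiser of \<open>J\<close> along the line through \<open>y\<close> in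
      direction \<open>x\<close>; it would lower \<open>J\<close> by
      \<open>d^2 / (norm x)^2\<close>, so \<open>d\<close> must vanish.\<close>
    define t where "t = d / (norm x)\<^sup>2"
    have "J (y + t *\<^sub>R x) - J y = t\<^sup>2 * (norm x)\<^sup>2 - 2 * t * d"
      unfolding J_def d_def f.scaleR f.add
      by (simp add: power2_norm_eq_inner inner_add inner_commute algebra_simps)
        (simp add: power2_eq_square)
    also have "\<dots> = - d\<^sup>2 / (norm x)\<^sup>2"
      using False unfolding t_def by (simp add: power2_eq_square field_simps)
    finally have "d\<^sup>2 / (norm x)\<^sup>2 \<le> 0"
      using min[of "y + t *\<^sub>R x"] by simp
    then have "d = 0"
      using False by (simp add: divide_le_0_iff)
    then show ?thesis unfolding d_def by simp
  qed (simp add: f.zero)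
  then show thesis by (rule that)
qed

text \<open>Banach-Steinhaus by Baire category, on a closed subspace rather than on a whole type.
  The intended \<open>H\<close> is the graph of a closed operator: its product norm is equivalent to
  the graph norm on the domain, and the maps are linear only there.\<close>

lemma uniform_boundedness_on:
  fixes H :: "'a::banach set" and T :: "'i \<Rightarrow> 'a \<Rightarrow> 'b::real_normed_vector"
  assumes H: "subspace H" "closed H"
    and add: "\<And>i p q. i \<in> I \<Longrightarrow> p \<in> H \<Longrightarrow> q \<in> H \<Longrightarrow> T i (p + q) = T i p + T i q"
    and scale: "\<And>i a p. i \<in> I \<Longrightarrow> p \<in> H \<Longrightarrow> T i (a *\<^sub>R p) = a *\<^sub>R T i p"
    and bound: "\<And>i. i \<in> I \<Longrightarrow> \<exists>c. \<forall>p\<in>H. norm (T i p) \<le> c * norm p"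
    and pointwise: "\<And>p. p \<in> H \<Longrightarrow> \<exists>c. \<forall>i\<in>I. norm (T i p) \<le> c"
  obtains K where "K \<ge> 0" "\<And>i p. i \<in> I \<Longrightarrow> p \<in> H \<Longrightarrow> norm (T i p) \<le> K * norm p"
proof -
  have diff: "T i (p - q) = T i p - T i q" if "i \<in> I" "p \<in> H" "q \<in> H" for i p q
    using add[of i "p - q" q] that subspace_diff[OF H(1)] by simp
  have cont: "continuous_on H (T i)" if i: "i \<in> I" for i
  proof -
    obtain c where c: "\<And>p. p \<in> H \<Longrightarrow> norm (T i p) \<le> c * norm p"
      using bound[OF i] by blast
    show ?thesis
      unfolding continuous_on_iff
    proof (intro ballI allI impI)
      fix p and e :: real assume p: "p \<in> H" and "e > 0"
      have "dist (T i q) (T i p) < e" if q: "q \<in> H" and d: "dist q p < e / (\<bar>c\<bar> + 1)" for q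
      proof -
        have "norm (T i q - T i p) \<le> c * norm (q - p)"
          using c[of "q - p"] diff[OF i q p] subspace_diff[OF H(1) q p] by simp
        also have "\<dots> \<le> (\<bar>c\<bar> + 1) * norm (q - p)"
          by (intro mult_right_mono) auto
        also have "\<dots> < e"
          using d by (simp add: dist_norm field_simps)
        finally show ?thesis by (simp add: dist_norm)
      qed
      then show "\<exists>d>0. \<forall>q\<in>H. dist q p < d \<longrightarrow> dist (T i q) (T i p) < e"
        using \<open>e > 0\<close> by (intro exI[of _ "e / (\<bar>c\<bar> + 1)"]) auto
    qed
  qed
  define C where "C n = {p \<in> H. \<forall>i\<in>I. norm (T i p) \<le> real n}" for n :: nat
  have closed_C: "closedin (top_of_set H) (C n)" for n
  proof (cases "I = {}")
    case False
    have "C n = (\<Inter>i\<in>I. H \<inter> T i -` cball 0 (real n))"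
      using False unfolding C_def by auto
    also have "closedin (top_of_set H) \<dots>"
      using False by (intro closedin_INT continuous_closedin_preimage cont) auto
    finally show ?thesis .
  qed (simp add: C_def)
  have cover: "\<Union>(range C) = H"
  proof (intro equalityI subsetI)
    fix p assume p: "p \<in> H"
    then obtain c where c: "\<forall>i\<in>I. norm (T i p) \<le> c" using pointwise by blast
    obtain n where "c \<le> real n" using real_arch_simple by blast
    then have "p \<in> C n"
      unfolding C_def using p c by (auto intro: order_trans)
    then show "p \<in> \<Union>(range C)" by blast
  qed (auto simp: C_def)
  \<comment> \<open>The closed sets \<open>C n\<close> cover \<open>H\<close> by pointwise
    boundedness. As \<open>H\<close> is complete and contains 0, they cannot all have empty
    interior.\<close>
  have "\<exists>n. top_of_set H interior_of C n \<noteq> {}"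
  proof (rule ccontr)
    assume "\<not> ?thesis"
    then have "top_of_set H interior_of \<Union>(range C) = {}"
      using closed_C H(2)
      by (intro Baire_category_alt disjI1)
         (auto intro: completely_metrizable_space_closedin completely_metrizable_space_euclidean)
    then show False
      using cover subspace_0[OF H(1)] interior_of_topspace[of "top_of_set H"] by auto
  qed
  then obtain n p0 where "p0 \<in> top_of_set H interior_of C n" by blast
  then obtain O' where "openin (top_of_set H) O'" and O': "p0 \<in> O'" "O' \<subseteq> C n"
    unfolding interior_of_def by blast
  then obtain e where e: "e > 0" "ball p0 e \<inter> H \<subseteq> O'" and p0: "p0 \<in> H"
    unfolding openin_contains_ball by blast
  show thesis
  proof
    show "0 \<le> 4 * real n / e" using e by simp
    fix i p assume i: "i \<in> I" and p: "p \<in> H"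
    show "norm (T i p) \<le> 4 * real n / e * norm p"
    proof (cases "p = 0")
      case True
      then show ?thesis using scale[OF i p, of 0] by simp
    next
      case False
      \<comment> \<open>This scaling keeps \<open>p0 + a p\<close> inside the ball on which all maps
        are bounded by \<open>n\<close>; subtracting the value at \<open>p0\<close> costs another
        \<open>n\<close>, whence the constant \<open>4 n / e\<close>.\<close>
      define a where "a = e / (2 * norm p)"
      have a: "a > 0" using False e by (simp add: a_def)
      have ap: "a *\<^sub>R p \<in> H" using p H(1) by (simp add: subspace_scale)
      then have q: "p0 + a *\<^sub>R p \<in> H" using p0 H(1) by (simp add: subspace_add)
      have "norm (a *\<^sub>R p) < e" using False e by (simp add: a_def)
      then have "p0 + a *\<^sub>R p \<in> C n" "p0 \<in> C n"
        using e O' q by (auto simp: dist_norm subset_iff)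
      then have "norm (T i (p0 + a *\<^sub>R p)) \<le> real n" "norm (T i p0) \<le> real n"
        using i by (auto simp: C_def)
      moreover have "T i (p0 + a *\<^sub>R p) = T i p0 + a *\<^sub>R T i p"
        using add[OF i p0 ap] scale[OF i p] by simp
      ultimately have "norm (a *\<^sub>R T i p) \<le> 2 * real n"
        by (smt (verit) norm_diff_triangle_ineq norm_triangle_ineq2 add_diff_cancel_left' norm_triangle_ineq4)
      then have "a * norm (T i p) \<le> 2 * real n" using a by simp
      then show ?thesis using False e by (simp add: a_def field_simps)
    qed
  qed
qed

section \<open>Adjoints of unbounded operators\<close>

text \<open>The vector \<open>y\<close> is the Hilbert space adjoint of \<open>R\<close> applied to
  \<open>q\<close>, obtained from Riesz representation. Since \<open>R\<close> is a left inverse of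
  \<open>\<beta> - A\<close>, its adjoint is a right inverse of \<open>\<beta>\<close> minus the
  adjoint of \<open>A\<close>.\<close>

lemma adjoint_resolvent:
  fixes A :: "('x::{real_inner, banach} \<times> 'x) set"
  assumes R: "is_resolvent A \<beta> R"
  obtains y where "(y, \<beta> *\<^sub>R y - q) \<in> op_adjoint A" "\<And>x. inner (R x) q = inner x y"
    "norm y \<le> onorm R * norm q"
proof -
  have bl: "bounded_linear R" using R by (simp add: is_resolvent_def)
  have "bounded_linear (\<lambda>x. inner (R x) q)"
    by (rule bounded_linear_compose[OF bounded_linear_inner_left bl])
  then obtain y where y: "\<And>x. inner (R x) q = inner x y"
    by (rule riesz_representation) blast
  show thesis
  proof
    show "inner (R x) q = inner x y" for x by (rule y)
    have "inner w y = inner x (\<beta> *\<^sub>R y - q)" if "(x, w) \<in> A" for x w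
    proof -
      have "R (\<beta> *\<^sub>R x - w) = x"
        using R that by (auto simp: is_resolvent_def)
      then have "inner x q = inner (\<beta> *\<^sub>R x - w) y" by (metis y)
      then show ?thesis by (simp add: inner_diff)
    qed
    then show "(y, \<beta> *\<^sub>R y - q) \<in> op_adjoint A" by (auto simp: op_adjoint_def)
    have "norm y * norm y = inner (R y) q"
      using y[of y] by (simp add: dot_square_norm power2_eq_square)
    also have "\<dots> \<le> norm (R y) * norm q" by (rule norm_cauchy_schwarz)
    also have "\<dots> \<le> (onorm R * norm y) * norm q"
      by (intro mult_right_mono onorm[OF bl]) auto
    finally have "norm y * norm y \<le> (onorm R * norm q) * norm y" by (simp add: mult_ac)
    then show "norm y \<le> onorm R * norm q"
      by (cases "y = 0") (auto simp: onorm_pos_le[OF bl])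
  qed
qed

lemma op_adjoint_subspace: "subspace (op_adjoint A)"
  unfolding subspace_def op_adjoint_def
  by (auto simp: inner_add_right zero_prod_def split_beta)

lemma op_adjoint_closed: "closed (op_adjoint A)"
proof -
  have "op_adjoint A = (\<Inter>(x, w)\<in>A. {p. inner w (fst p) = inner x (snd p)})"
    unfolding op_adjoint_def by auto
  also have "closed \<dots>"
    by (intro closed_INT ballI) (auto split: prod.split intro!: closed_Collect_eq continuous_intros)
  finally show ?thesis .
qed

section \<open>Bochner and Henstock--Kurzweil integrability\<close>

text \<open>A simple function is a finite sum of its values times indicators of its level sets, and
  each level set meets the interval in a set of finite measure.\<close>

lemma simple_function_integrable_on_interval:
  fixes \<phi> :: "real \<Rightarrow> 'b::real_normed_vector"
  assumes "simple_function lebesgue \<phi>"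
  shows "\<phi> integrable_on {a..b}"
proof -
  have fin: "finite (range \<phi>)"
    using assms by (simp add: simple_function_def)
  have meas: "\<phi> -` {y} \<in> sets lebesgue" for y
    using simple_functionD(2)[OF assms, of "{y}"] by simp
  have repr: "\<phi> = (\<lambda>x. \<Sum>y\<in>range \<phi>. indicat_real (\<phi> -` {y}) x *\<^sub>R y)"
  proof
    fix x
    have "(\<Sum>y\<in>range \<phi>. indicat_real (\<phi> -` {y}) x *\<^sub>R y) = (\<Sum>y\<in>range \<phi>. if y = \<phi> x then y else 0)"
      by (intro sum.cong) (auto simp: indicator_def)
    then show "\<phi> x = (\<Sum>y\<in>range \<phi>. indicat_real (\<phi> -` {y}) x *\<^sub>R y)"
      using fin by (simp add: sum.delta)
  qed
  have "\<phi> -` {y} \<inter> {a..b} \<in> lmeasurable" for y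
    using meas[of y] by (metis fmeasurable_Int_fmeasurable inf_commute lmeasurable_interval(1))
  then have "(\<lambda>x. indicat_real (\<phi> -` {y}) x *\<^sub>R y) integrable_on {a..b}" for y
    by (intro integrable_on_scaleR_left) (simp add: integrable_on_indicator)
  then show ?thesis
    by (subst repr) (intro integrable_sum fin)
qed

text \<open>Cauchy criterion for gauge integrals: a Riemann sum of \<open>f\<close> differs from the
  one of \<open>g\<close> by at most the Riemann sum of \<open>norm (f - g)\<close>, which a fine
  division keeps close to the small integral of that function.\<close>

lemma integrable_on_L1_limit:
  fixes f :: "real \<Rightarrow> 'b::banach"
  assumes approx: "\<And>e. e > 0 \<Longrightarrow> \<exists>g. g integrable_on {a..b} \<and>
      (\<lambda>r. norm (f r - g r)) integrable_on {a..b} \<and> integral {a..b} (\<lambda>r. norm (f r - g r)) < e"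
  shows "f integrable_on {a..b}"
  unfolding cbox_interval[symmetric]
proof (subst integrable_Cauchy, intro allI impI)
  fix e :: real assume "e > 0"
  \<comment> \<open>Each fine Riemann sum of \<open>f\<close> will lie within \<open>3 * d\<close>
    of the integral of \<open>g\<close>: \<open>2 * d\<close> from the norm of the difference and
    \<open>d\<close> from \<open>g\<close> itself. Two such sums then differ by less than
    \<open>6 * d < e\<close>.\<close>
  define d where "d = e / 8"
  have d: "d > 0" using \<open>e > 0\<close> by (simp add: d_def)
  obtain g where g: "g integrable_on {a..b}" and fg: "(\<lambda>r. norm (f r - g r)) integrable_on {a..b}"
    and less: "integral {a..b} (\<lambda>r. norm (f r - g r)) < d"
    using approx[OF d] by blast
  let ?n = "\<lambda>r. norm (f r - g r)"
  obtain \<gamma>1 where \<gamma>1: "gauge \<gamma>1" "\<And>\<D>. \<D> tagged_division_of {a..b} \<Longrightarrow> \<gamma>1 fine \<D> \<Longrightarrow>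
      norm ((\<Sum>(x,k)\<in>\<D>. measure lborel k *\<^sub>R g x) - integral {a..b} g) < d"
    using has_integralD[OF integrable_integral[OF g, folded cbox_interval] d]
    unfolding cbox_interval by blast
  obtain \<gamma>2 where \<gamma>2: "gauge \<gamma>2" "\<And>\<D>. \<D> tagged_division_of {a..b} \<Longrightarrow> \<gamma>2 fine \<D> \<Longrightarrow>
      norm ((\<Sum>(x,k)\<in>\<D>. measure lborel k *\<^sub>R ?n x) - integral {a..b} ?n) < d"
    using has_integralD[OF integrable_integral[OF fg, folded cbox_interval] d]
    unfolding cbox_interval by blast
  have near: "norm ((\<Sum>(x,k)\<in>\<D>. measure lborel k *\<^sub>R f x) - integral {a..b} g) < 3 * d"
    if D: "\<D> tagged_division_of {a..b}" and fine: "(\<lambda>x. \<gamma>1 x \<inter> \<gamma>2 x) fine \<D>" for \<D>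
  proof -
    have f1: "\<gamma>1 fine \<D>" and f2: "\<gamma>2 fine \<D>" using fine by (auto simp: fine_Int)
    have "norm ((\<Sum>(x,k)\<in>\<D>. measure lborel k *\<^sub>R f x) - (\<Sum>(x,k)\<in>\<D>. measure lborel k *\<^sub>R g x))
        = norm (\<Sum>(x,k)\<in>\<D>. measure lborel k *\<^sub>R (f x - g x))"
      by (simp add: sum_subtractf[symmetric] case_prod_beta scaleR_diff_right)
    also have "\<dots> \<le> (\<Sum>(x,k)\<in>\<D>. measure lborel k *\<^sub>R ?n x)"
      by (rule sum_norm_le) auto
    also have "\<dots> < 2 * d"
      using \<gamma>2(2)[OF D f2] less by (simp add: abs_if split: if_splits)
    finally show ?thesis
      using \<gamma>1(2)[OF D f1] norm_triangle_ineq[of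
        "(\<Sum>(x,k)\<in>\<D>. measure lborel k *\<^sub>R f x) - (\<Sum>(x,k)\<in>\<D>. measure lborel k *\<^sub>R g x)"
        "(\<Sum>(x,k)\<in>\<D>. measure lborel k *\<^sub>R g x) - integral {a..b} g"] by simp
  qed
  show "\<exists>\<gamma>. gauge \<gamma> \<and> (\<forall>\<D>1 \<D>2. \<D>1 tagged_division_of cbox a b \<and> \<gamma> fine \<D>1 \<and>
      \<D>2 tagged_division_of cbox a b \<and> \<gamma> fine \<D>2 \<longrightarrow>
      norm ((\<Sum>(x,k)\<in>\<D>1. measure lborel k *\<^sub>R f x) - (\<Sum>(x,k)\<in>\<D>2. measure lborel k *\<^sub>R f x)) < e)"
  proof (intro exI conjI allI impI)
    show "gauge (\<lambda>x. \<gamma>1 x \<inter> \<gamma>2 x)" using \<gamma>1(1) \<gamma>2(1) by (rule gauge_Int)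
    fix \<D>1 \<D>2
    assume D: "\<D>1 tagged_division_of cbox a b \<and> (\<lambda>x. \<gamma>1 x \<inter> \<gamma>2 x) fine \<D>1 \<and>
      \<D>2 tagged_division_of cbox a b \<and> (\<lambda>x. \<gamma>1 x \<inter> \<gamma>2 x) fine \<D>2"
    have "dist (\<Sum>(x,k)\<in>\<D>1. measure lborel k *\<^sub>R f x) (\<Sum>(x,k)\<in>\<D>2. measure lborel k *\<^sub>R f x)
        \<le> dist (\<Sum>(x,k)\<in>\<D>1. measure lborel k *\<^sub>R f x) (integral {a..b} g)
          + dist (\<Sum>(x,k)\<in>\<D>2. measure lborel k *\<^sub>R f x) (integral {a..b} g)"
      by (rule dist_triangle2)
    also have "\<dots> < e"
      using near[of \<D>1] near[of \<D>2] D d unfolding dist_norm d_def by simp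
    finally show "norm ((\<Sum>(x,k)\<in>\<D>1. measure lborel k *\<^sub>R f x) - (\<Sum>(x,k)\<in>\<D>2. measure lborel k *\<^sub>R f x)) < e"
      by (simp add: dist_norm)
  qed
qed

text \<open>Links Bochner integrability, which the definitions demand, to the Henstock-Kurzweil
  integral in which the input term is written. Truncated simple functions converge to
  \<open>f\<close> in the integral norm by dominated convergence, and integrability passes to such
  limits.\<close>

lemma bochner_integrable_imp_integrable:
  fixes f :: "real \<Rightarrow> 'b::banach"
  assumes "bochner_integrable_on f {a..b}"
  shows "f integrable_on {a..b}"
proof -
  define h where "h r = indicat_real {a..b} r *\<^sub>R norm (f r)" for r
  have ai: "(\<lambda>r. norm (f r)) absolutely_integrable_on {a..b}"
    using assms by (simp add: bochner_integrable_on_def)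
  then have h_meas [measurable]: "h \<in> borel_measurable lebesgue"
    unfolding set_integrable_def h_def by (rule borel_measurable_integrable)
  have "h integrable_on {a..b} \<longleftrightarrow> (\<lambda>r. norm (f r)) integrable_on {a..b}"
    by (rule integrable_cong) (simp add: h_def)
  then have h_int: "h integrable_on {a..b}"
    using ai by (simp add: absolutely_integrable_on_def)
  obtain \<phi> where simple: "\<And>n::nat. simple_function lebesgue (\<phi> n)"
    and "AE r in lebesgue. r \<in> {a..b} \<longrightarrow> (\<lambda>n. \<phi> n r) \<longlonglongrightarrow> f r"
    using assms unfolding bochner_integrable_on_def strongly_measurable_on_def by blast
  then obtain N where N: "N \<in> null_sets lebesgue"
    and conv: "\<And>r. r \<in> {a..b} - N \<Longrightarrow> (\<lambda>n. \<phi> n r) \<longlonglongrightarrow> f r"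
    unfolding eventually_ae_filter by auto
  \<comment> \<open>Zero on the exceptional set and outside the interval, so that the approximation
    below converges at every point; the null set is dealt with at the very end.\<close>
  define f' where "f' r = (if r \<in> {a..b} - N then f r else 0)" for r
  \<comment> \<open>cutting \<open>\<phi> n\<close> off where it exceeds \<open>2 * norm (f r)\<close> makes the sequence dominated\<close>
  define \<psi> where "\<psi> n r = (if norm (\<phi> n r) \<le> 2 * h r \<and> r \<in> {a..b} - N then \<phi> n r else 0)" for n r
  have \<psi>_simple: "simple_function lebesgue (\<psi> n)" for n
  proof -
    have "(\<lambda>r. norm (\<phi> n r)) \<in> borel_measurable lebesgue"
      by (rule borel_measurable_simple_function) (rule simple_function_compose1[OF simple])
    then have "{r \<in> space lebesgue. norm (\<phi> n r) \<le> 2 * h r} \<in> sets lebesgue"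
      by measurable
    moreover have "{a..b} - N \<in> sets lebesgue"
      using N by auto
    ultimately have "{r \<in> space lebesgue. norm (\<phi> n r) \<le> 2 * h r} \<inter> ({a..b} - N) \<in> sets lebesgue"
      by (rule sets.Int)
    then have "{r \<in> space lebesgue. norm (\<phi> n r) \<le> 2 * h r \<and> r \<in> {a..b} - N} \<in> sets lebesgue"
      by (rule back_subst) auto
    then show ?thesis
      unfolding \<psi>_def by (intro simple_function_If simple) auto
  qed
  have \<psi>_bound: "norm (\<psi> n r) \<le> 2 * h r" for n r
    by (simp add: \<psi>_def) (simp add: h_def)
  have f'_bound: "norm (f' r) \<le> h r" for r
    by (simp add: f'_def h_def)
  \<comment> \<open>Where \<open>f r\<close> is nonzero, \<open>norm (f r)\<close> is strictly below
    the cut-off level, so the cut-off is eventually inactive. Where it vanishes, so does the cut-off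
    level, and every \<open>\<psi> n r\<close> is 0.\<close>
  have \<psi>_lim: "(\<lambda>n. \<psi> n r) \<longlonglongrightarrow> f' r" for r
  proof (cases "r \<in> {a..b} - N \<and> f r \<noteq> 0")
    case True
    have "(\<lambda>n. norm (\<phi> n r)) \<longlonglongrightarrow> norm (f r)"
      using True by (intro tendsto_norm conv) simp
    moreover have "norm (f r) < 2 * h r" using True by (simp add: h_def)
    ultimately have "\<forall>\<^sub>F n in sequentially. norm (\<phi> n r) < 2 * h r"
      by (rule order_tendstoD(2))
    then have "\<forall>\<^sub>F n in sequentially. \<phi> n r = \<psi> n r"
      by eventually_elim (use True in \<open>simp add: \<psi>_def\<close>)
    then show ?thesis
      using conv[of r] True by (simp add: f'_def tendsto_cong)
  next
    case False
    then have "\<psi> n r = 0" for n by (auto simp: \<psi>_def h_def)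
    then show ?thesis using False by (auto simp: f'_def)
  qed
  \<comment> \<open>Integrability of \<open>f'\<close> is still unknown, so this real-valued
    function is obtained as a dominated limit of differences of two simple functions.\<close>
  have norm_diff: "(\<lambda>r. norm (f' r - \<psi> k r)) integrable_on {a..b}" for k
  proof (rule dominated_convergence(1))
    show "(\<lambda>r. norm (\<psi> m r - \<psi> k r)) integrable_on {a..b}" for m
      by (intro simple_function_integrable_on_interval simple_function_compose1[of _ _ norm]
          simple_function_diff \<psi>_simple)
    show "(\<lambda>r. 4 * h r) integrable_on {a..b}"
      using integrable_on_cmult_left[OF h_int] by simp
    show "norm (norm (\<psi> m r - \<psi> k r)) \<le> 4 * h r" for m r
      using norm_triangle_ineq4[of "\<psi> m r" "\<psi> k r"] \<psi>_bound[of m r] \<psi>_bound[of k r] by simp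
    show "(\<lambda>m. norm (\<psi> m r - \<psi> k r)) \<longlonglongrightarrow> norm (f' r - \<psi> k r)" for r
      by (intro tendsto_intros \<psi>_lim)
  qed
  have "(\<lambda>k. integral {a..b} (\<lambda>r. norm (f' r - \<psi> k r))) \<longlonglongrightarrow> integral {a..b} (\<lambda>r. 0)"
  proof (rule dominated_convergence(2))
    show "(\<lambda>r. norm (f' r - \<psi> k r)) integrable_on {a..b}" for k by (rule norm_diff)
    show "(\<lambda>r. 3 * h r) integrable_on {a..b}"
      using integrable_on_cmult_left[OF h_int] by simp
    show "norm (norm (f' r - \<psi> k r)) \<le> 3 * h r" for k r
      using norm_triangle_ineq4[of "f' r" "\<psi> k r"] \<psi>_bound[of k r] f'_bound[of r] by simp
    show "(\<lambda>k. norm (f' r - \<psi> k r)) \<longlonglongrightarrow> 0" for r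
      using tendsto_norm[OF tendsto_diff[OF tendsto_const \<psi>_lim], of "f' r" r] by simp
  qed
  then have lim: "(\<lambda>k. integral {a..b} (\<lambda>r. norm (f' r - \<psi> k r))) \<longlonglongrightarrow> 0" by simp
  have "f' integrable_on {a..b}"
  proof (rule integrable_on_L1_limit)
    fix e :: real assume "e > 0"
    then obtain k where "integral {a..b} (\<lambda>r. norm (f' r - \<psi> k r)) < e"
      using order_tendstoD(2)[OF lim, of e] eventually_happens'[OF sequentially_bot] by blast
    then show "\<exists>g. g integrable_on {a..b} \<and> (\<lambda>r. norm (f' r - g r)) integrable_on {a..b} \<and>
        integral {a..b} (\<lambda>r. norm (f' r - g r)) < e"
      using norm_diff \<psi>_simple simple_function_integrable_on_interval by blast
  qed
  then show ?thesis
    by (rule integrable_spike[where S = N]) (use N in \<open>auto simp: f'_def negligible_iff_null_sets\<close>)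
qed

section \<open>Semigroups and the Kato class\<close>

lemma generator_unique:
  assumes "(x, y) \<in> generator S" "(x, y') \<in> generator S"
  shows "y = y'"
  using assms tendsto_unique[of "at_right (0::real)"] unfolding generator_def by auto

text \<open>\<open>S t\<close> is continuous and commutes with \<open>S h\<close>, so it carries the
  difference quotients at \<open>x\<close> to those at \<open>S t x\<close>.\<close>

lemma generator_invariant:
  assumes S: "C0_semigroup S" and t: "t \<ge> 0" and xy: "(x, y) \<in> generator S"
  shows "(S t x, S t y) \<in> generator S"
proof -
  have bl: "bounded_linear (S t)" using S t by (simp add: C0_semigroup_def)
  interpret St: bounded_linear "S t" by fact
  have "((\<lambda>h. S t ((S h x - x) /\<^sub>R h)) \<longlongrightarrow> S t y) (at_right 0)"
    using xy unfolding generator_def by (intro St.tendsto) simp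
  moreover have "\<forall>\<^sub>F h in at_right 0. S t ((S h x - x) /\<^sub>R h) = (S h (S t x) - S t x) /\<^sub>R h"
    unfolding eventually_at_right_field
  proof (intro exI[of _ 1] conjI allI impI)
    fix h :: real assume "0 < h" "h < 1"
    then have "S t (S h x) = S h (S t x)"
      using S t unfolding C0_semigroup_def by (metis add.commute less_eq_real_def)
    then show "S t ((S h x - x) /\<^sub>R h) = (S h (S t x) - S t x) /\<^sub>R h"
      by (simp add: St.scaleR St.diff)
  qed simp
  ultimately show ?thesis
    unfolding generator_def by (simp add: tendsto_cong)
qed

text \<open>The right derivative is \<open>S t\<close> applied to the generator quotient. The left
  derivative involves the varying operators \<open>S (t - h)\<close> and is controlled by the
  uniform bound \<open>K\<close>.\<close>

lemma C0_semigroup_has_vector_derivative: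
  assumes S: "C0_semigroup S" and xy: "(x, y) \<in> generator S" and t: "t > 0"
    and K: "\<And>r z. r \<ge> 0 \<Longrightarrow> norm (S r z) \<le> K * norm z"
  shows "((\<lambda>r. S r x) has_vector_derivative S t y) (at t)"
proof -
  define F where "F h = (S (t + h) x - S t x) /\<^sub>R h" for h
  have lin: "linear (S r)" if "r \<ge> 0" for r
    using S that by (simp add: C0_semigroup_def bounded_linear.linear)
  have comp: "S (a + b) z = S a (S b z)" if "a \<ge> 0" "b \<ge> 0" for a b z
    using S that by (simp add: C0_semigroup_def)
  define q where "q h = (S h x - x) /\<^sub>R h" for h
  have q: "(q \<longlongrightarrow> y) (at_right 0)"
    using xy unfolding generator_def q_def by simp
  have y: "((\<lambda>h. S h y) \<longlongrightarrow> y) (at_right 0)"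
  proof -
    have "continuous_on {0..} (\<lambda>h. S h y)" "S 0 y = y"
      using S by (auto simp: C0_semigroup_def)
    then have "((\<lambda>h. S h y) \<longlongrightarrow> y) (at 0 within {0..})"
      unfolding continuous_on_def by force
    then show ?thesis
      by (rule tendsto_within_subset) auto
  qed
  have right: "(F \<longlongrightarrow> S t y) (at_right 0)"
  proof -
    interpret St: bounded_linear "S t" using S t by (simp add: C0_semigroup_def)
    have "((\<lambda>h. S t (q h)) \<longlongrightarrow> S t y) (at_right 0)"
      by (rule St.tendsto[OF q])
    moreover have "\<forall>\<^sub>F h in at_right 0. S t (q h) = F h"
      unfolding eventually_at_right_field
      by (intro exI[of _ 1]) (use t comp in \<open>auto simp: F_def q_def St.scaleR St.diff\<close>)
    ultimately show ?thesis by (simp add: tendsto_cong)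
  qed
  \<comment> \<open>For the left quotient: \<open>F (- h)\<close> is \<open>S (t - h) (q h)\<close>
    and \<open>S t y\<close> is \<open>S (t - h) (S h y)\<close>. Both arguments tend to
    \<open>y\<close>, and \<open>S (t - h)\<close> enlarges their difference by at most the factor
    \<open>K\<close>.\<close>
  have "((\<lambda>h. q h - S h y) \<longlongrightarrow> y - y) (at_right 0)"
    by (intro tendsto_diff q y)
  then have "((\<lambda>h. K * norm (q h - S h y)) \<longlongrightarrow> K * 0) (at_right 0)"
    by (intro tendsto_intros tendsto_norm_zero) simp
  then have "((\<lambda>h. K * norm (q h - S h y)) \<longlongrightarrow> 0) (at_right 0)" by simp
  then have "((\<lambda>h. F (- h) - S t y) \<longlongrightarrow> 0) (at_right 0)"
  proof (rule Lim_null_comparison[rotated])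
    show "\<forall>\<^sub>F h in at_right 0. norm (F (- h) - S t y) \<le> K * norm (q h - S h y)"
      unfolding eventually_at_right_field
    proof (intro exI[of _ t] conjI allI impI)
      fix h assume h: "0 < h" "h < t"
      have *: "S (t - h) (S h z) = S t z" for z
        using comp[of "t - h" h z] h by simp
      have "F (- h) = S (t - h) (q h)"
        unfolding F_def q_def using h lin[of "t - h"] *
        by (simp add: linear_diff linear_scale scaleR_diff_right)
      then have "F (- h) - S t y = S (t - h) (q h - S h y)"
        using h lin[of "t - h"] * by (simp add: linear_diff)
      then show "norm (F (- h) - S t y) \<le> K * norm (q h - S h y)"
        using K[of "t - h"] h by simp
    qed (use t in simp)
  qed
  then have "(F \<longlongrightarrow> S t y) (at_left 0)"
    using at_left_minus[of "0::real"] by (simp add: filterlim_filtermap LIM_zero_iff)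
  then have "(F \<longlongrightarrow> S t y) (at 0)"
    using right filterlim_split_at by blast
  then have "((\<lambda>h. norm (F h - S t y)) \<longlongrightarrow> 0) (at 0)"
    by (simp add: LIM_zero tendsto_norm_zero)
  moreover have "\<forall>\<^sub>F h in at 0. norm (F h - S t y) = norm (S (t + h) x - S t x - h *\<^sub>R S t y) / norm h"
  proof -
    have "norm (F h - S t y) = norm (S (t + h) x - S t x - h *\<^sub>R S t y) / norm h" if "h \<noteq> 0" for h
    proof -
      have "F h - S t y = (S (t + h) x - S t x - h *\<^sub>R S t y) /\<^sub>R h"
        using that unfolding F_def by (simp add: scaleR_diff_right)
      then show ?thesis by (simp add: divide_inverse_commute)
    qed
    then show ?thesis by (simp add: eventually_at_filter)
  qed
  ultimately have "((\<lambda>h. norm (S (t + h) x - S t x - h *\<^sub>R S t y) / norm h) \<longlongrightarrow> 0) (at 0)"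
    by (simp add: tendsto_cong)
  then show ?thesis
    unfolding has_vector_derivative_def has_derivative_at
    by (simp add: bounded_linear_scaleR_left)
qed

section \<open>Lipschitz dependence on time in the graph norm\<close>

text \<open>For fixed \<open>x\<close> the difference quotients in time are bounded, by the mean
  value inequality. Uniform boundedness on the graph of \<open>g 0\<close>, a Banach space, turns
  this into a Lipschitz bound in the graph norm at time 0, and compactness of \<open>{0..T}\<close>
  allows the graph norm at any time \<open>r\<close> instead.\<close>

lemma graph_norm_lipschitz:
  fixes g :: "real \<Rightarrow> 'x::banach \<Rightarrow> 'x"
  assumes add: "\<And>t u v. t \<ge> 0 \<Longrightarrow> u \<in> D \<Longrightarrow> v \<in> D \<Longrightarrow> g t (u + v) = g t u + g t v"
    and scale: "\<And>t a v. t \<ge> 0 \<Longrightarrow> v \<in> D \<Longrightarrow> g t (a *\<^sub>R v) = a *\<^sub>R g t v"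
    and graph: "subspace ((\<lambda>v. (v, g 0 v)) ` D)" "closed ((\<lambda>v. (v, g 0 v)) ` D)"
    and equiv: "\<And>t s. t \<ge> 0 \<Longrightarrow> s \<ge> 0 \<Longrightarrow> \<exists>c. \<forall>x\<in>D. norm (g t x) \<le> c * (norm x + norm (g s x))"
    and C1: "\<And>x. x \<in> D \<Longrightarrow> \<exists>g'. continuous_on {0..} g' \<and>
        (\<forall>t\<ge>0. ((\<lambda>t. g t x) has_vector_derivative g' t) (at t within {0..}))"
    and T: "T \<ge> 0"
  obtains K where "K \<ge> 0" "\<And>a b r v. a \<in> {0..T} \<Longrightarrow> b \<in> {0..T} \<Longrightarrow> r \<in> {0..T} \<Longrightarrow> v \<in> D \<Longrightarrow>
      norm (g a v - g b v) \<le> K * \<bar>a - b\<bar> * (norm v + norm (g r v))"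
proof -
  define I where "I = {(a, b). a \<in> {0..T} \<and> b \<in> {0..T} \<and> a \<noteq> b}"
  \<comment> \<open>The quotients act on points of the graph of \<open>g 0\<close> but read only the
    first component; the second one merely puts the graph norm into \<open>norm p\<close>.\<close>
  define Q where "Q = (\<lambda>(a, b) p :: 'x \<times> 'x. (g a (fst p) - g b (fst p)) /\<^sub>R (a - b))"
  let ?H = "(\<lambda>v. (v, g 0 v)) ` D"
  obtain K1 where K1: "K1 \<ge> 0" "\<And>i p. i \<in> I \<Longrightarrow> p \<in> ?H \<Longrightarrow> norm (Q i p) \<le> K1 * norm p"
  proof (rule uniform_boundedness_on[OF graph, of I Q])
    fix i p q assume "i \<in> I" "p \<in> ?H" "q \<in> ?H"
    then show "Q i (p + q) = Q i p + Q i q"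
      by (auto simp: I_def Q_def add scaleR_diff_right scaleR_add_right)
  next
    fix i a p assume "i \<in> I" "p \<in> ?H"
    then show "Q i (a *\<^sub>R p) = a *\<^sub>R Q i p"
      by (auto simp: I_def Q_def scale scaleR_diff_right mult.commute)
  next
    fix i assume "i \<in> I"
    then obtain a b where i: "i = (a, b)" "a \<in> {0..T}" "b \<in> {0..T}"
      by (auto simp: I_def)
    obtain ca where ca: "\<And>x. x \<in> D \<Longrightarrow> norm (g a x) \<le> ca * (norm x + norm (g 0 x))"
      using equiv[of a 0] i by auto
    obtain cb where cb: "\<And>x. x \<in> D \<Longrightarrow> norm (g b x) \<le> cb * (norm x + norm (g 0 x))"
      using equiv[of b 0] i by auto
    define c where "c = 2 * (\<bar>ca\<bar> + \<bar>cb\<bar>) / \<bar>a - b\<bar>"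
    have "norm (Q i p) \<le> c * norm p" if "p \<in> ?H" for p
    proof -
      from that obtain x where p: "p = (x, g 0 x)" "x \<in> D" by blast
      have gn: "0 \<le> norm x + norm (g 0 x)" "norm x + norm (g 0 x) \<le> 2 * norm p"
        using norm_fst_le[of x "g 0 x"] norm_snd_le[of "g 0 x" x] p by auto
      have "norm (g a x - g b x) \<le> norm (g a x) + norm (g b x)"
        by (rule norm_triangle_ineq4)
      also have "\<dots> \<le> ca * (norm x + norm (g 0 x)) + cb * (norm x + norm (g 0 x))"
        using ca cb p by (intro add_mono)
      also have "\<dots> \<le> (\<bar>ca\<bar> + \<bar>cb\<bar>) * (norm x + norm (g 0 x))"
        unfolding distrib_right[symmetric] using gn by (intro mult_right_mono) auto
      also have "\<dots> \<le> (\<bar>ca\<bar> + \<bar>cb\<bar>) * (2 * norm p)"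
        using gn by (intro mult_left_mono) auto
      finally have "norm (g a x - g b x) / \<bar>a - b\<bar> \<le> ((\<bar>ca\<bar> + \<bar>cb\<bar>) * (2 * norm p)) / \<bar>a - b\<bar>"
        by (rule divide_right_mono) simp
      also have "norm (g a x - g b x) / \<bar>a - b\<bar> = norm (Q i p)"
        by (simp add: Q_def i p divide_inverse_commute)
      also have "((\<bar>ca\<bar> + \<bar>cb\<bar>) * (2 * norm p)) / \<bar>a - b\<bar> = c * norm p"
        by (simp add: c_def)
      finally show ?thesis .
    qed
    then show "\<exists>c. \<forall>p\<in>?H. norm (Q i p) \<le> c * norm p" by blast
  next
    fix p assume "p \<in> ?H"
    then obtain x where p: "p = (x, g 0 x)" and x: "x \<in> D" by blast
    obtain g' where g': "continuous_on {0..} g'"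
      "\<And>t. t \<ge> 0 \<Longrightarrow> ((\<lambda>t. g t x) has_vector_derivative g' t) (at t within {0..})"
      using C1[OF x] by blast
    have "compact (g' ` {0..T})"
      using g'(1) by (intro compact_continuous_image compact_Icc) (rule continuous_on_subset, auto)
    then obtain c where c: "\<And>t. t \<in> {0..T} \<Longrightarrow> norm (g' t) \<le> c"
      using compact_imp_bounded bounded_iff by (metis imageI)
    have "norm (g a x - g b x) \<le> c * norm (a - b)" if "a \<in> {0..T}" "b \<in> {0..T}" for a b
    proof (rule differentiable_bound[where S = "{0..T}" and f' = "\<lambda>t h. h *\<^sub>R g' t"])
      show "((\<lambda>t. g t x) has_derivative (\<lambda>h. h *\<^sub>R g' t)) (at t within {0..T})" if "t \<in> {0..T}" for t
        using g'(2)[of t] that unfolding has_vector_derivative_def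
        by (auto intro: has_derivative_subset)
      show "onorm (\<lambda>h. h *\<^sub>R g' t) \<le> c" if "t \<in> {0..T}" for t
      proof (rule onorm_bound)
        show "0 \<le> c" using c[OF that] norm_ge_zero order_trans by blast
        show "norm (h *\<^sub>R g' t) \<le> c * norm h" for h
          using mult_right_mono[OF c[OF that], of "norm h"] by (simp add: mult.commute)
      qed
    qed (use that in auto)
    then have "norm (Q i p) \<le> c" if "i \<in> I" for i
      using that by (auto simp: I_def Q_def p divide_inverse_commute[symmetric] pos_divide_le_eq)
    then show "\<exists>c. \<forall>i\<in>I. norm (Q i p) \<le> c" by blast
  qed blast
  let ?gn = "\<lambda>r v. norm v + norm (g r v)"
  have lip0: "norm (g a v - g b v) \<le> K1 * \<bar>a - b\<bar> * ?gn 0 v"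
    if "a \<in> {0..T}" "b \<in> {0..T}" "v \<in> D" for a b v
  proof (cases "a = b")
    case False
    then have "norm (Q (a, b) (v, g 0 v)) \<le> K1 * norm (v, g 0 v)"
      using that by (intro K1) (auto simp: I_def)
    also have "\<dots> \<le> K1 * ?gn 0 v"
      by (intro mult_left_mono norm_Pair_le K1)
    finally show ?thesis
      using False
      by (simp add: Q_def divide_inverse_commute[symmetric] pos_divide_le_eq mult.assoc mult.commute[of _ "\<bar>a - b\<bar>"])
  qed (use K1 in simp)
  \<comment> \<open>Local-to-global by bisection: the bound holds on small intervals around each
    point and survives gluing. The intersection with \<open>{0..T}\<close> is there because such
    small intervals may stick out at the ends.\<close>
  have "\<exists>C\<ge>0. \<forall>r\<in>{0..T} \<inter> {0..T}. \<forall>v\<in>D. ?gn 0 v \<le> C * ?gn r v"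
  proof (rule Bolzano[OF T, of "\<lambda>a b. \<exists>C\<ge>0. \<forall>r\<in>{a..b} \<inter> {0..T}. \<forall>v\<in>D. ?gn 0 v \<le> C * ?gn r v"])
    fix a b c :: real
    assume "\<exists>C\<ge>0. \<forall>r\<in>{a..b} \<inter> {0..T}. \<forall>v\<in>D. ?gn 0 v \<le> C * ?gn r v"
      and "\<exists>C\<ge>0. \<forall>r\<in>{b..c} \<inter> {0..T}. \<forall>v\<in>D. ?gn 0 v \<le> C * ?gn r v"
    then obtain C1 C2 where C: "C1 \<ge> 0" "\<forall>r\<in>{a..b} \<inter> {0..T}. \<forall>v\<in>D. ?gn 0 v \<le> C1 * ?gn r v"
      "\<forall>r\<in>{b..c} \<inter> {0..T}. \<forall>v\<in>D. ?gn 0 v \<le> C2 * ?gn r v" by blast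
    have "?gn 0 v \<le> max C1 C2 * ?gn r v" if "r \<in> {a..c} \<inter> {0..T}" "v \<in> D" for r v
    proof -
      have "C1 * ?gn r v \<le> max C1 C2 * ?gn r v" "C2 * ?gn r v \<le> max C1 C2 * ?gn r v"
        by (intro mult_right_mono; simp)+
      moreover have "?gn 0 v \<le> C1 * ?gn r v \<or> ?gn 0 v \<le> C2 * ?gn r v"
        using C that by (cases "r \<le> b") auto
      ultimately show ?thesis by linarith
    qed
    then show "\<exists>C\<ge>0. \<forall>r\<in>{a..c} \<inter> {0..T}. \<forall>v\<in>D. ?gn 0 v \<le> C * ?gn r v"
      using C(1) by (intro exI[of _ "max C1 C2"]) auto
  next
    fix x assume x: "0 \<le> x" "x \<le> T"
    obtain c where c: "\<And>v. v \<in> D \<Longrightarrow> norm (g 0 v) \<le> c * ?gn x v"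
      using equiv[of 0 x] x by auto
    define C where "C = \<bar>c\<bar> + 1"
    have C: "C > 0" by (simp add: C_def)
    have cx: "?gn 0 v \<le> C * ?gn x v" if "v \<in> D" for v
    proof -
      define X where "X = ?gn x v"
      have "c * X \<le> \<bar>c\<bar> * X" unfolding X_def by (intro mult_right_mono) auto
      moreover have "norm v \<le> X" by (simp add: X_def)
      ultimately have "?gn 0 v \<le> \<bar>c\<bar> * X + X"
        using c[OF that] unfolding X_def[symmetric] by linarith
      then show ?thesis unfolding X_def[symmetric] C_def by (simp add: distrib_right)
    qed
    \<comment> \<open>Chosen so that \<open>C * K1 * d\<close> is at most 1/2. Passing from time
      \<open>x\<close> to \<open>r\<close> then costs at most half of the graph norm at 0, which is
      absorbed on the left.\<close>
    define d where "d = 1 / (2 * C * (K1 + 1))"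
    have d: "d > 0" using C K1 by (simp add: d_def)
    have "?gn 0 v \<le> 2 * C * ?gn r v" if r: "r \<in> {0..T}" "\<bar>x - r\<bar> < d" and v: "v \<in> D" for r v
    proof -
      have "C * (K1 * \<bar>x - r\<bar>) \<le> C * (K1 * d)"
        using r C K1 by (intro mult_left_mono) auto
      also have "\<dots> = K1 / (K1 + 1) / 2"
        using C by (simp add: d_def)
      also have "\<dots> \<le> 1/2"
        using K1(1) by simp
      finally have half: "C * (K1 * \<bar>x - r\<bar>) \<le> 1/2" .
      have "norm (g x v) \<le> norm (g r v) + norm (g x v - g r v)"
        by (metis add.commute diff_add_cancel norm_triangle_ineq)
      then have "?gn x v \<le> ?gn r v + K1 * \<bar>x - r\<bar> * ?gn 0 v"
        using lip0[of x r v] x r v by simp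
      then have "C * ?gn x v \<le> C * (?gn r v + K1 * \<bar>x - r\<bar> * ?gn 0 v)"
        using C by (intro mult_left_mono) auto
      then have "?gn 0 v \<le> C * ?gn r v + (C * (K1 * \<bar>x - r\<bar>)) * ?gn 0 v"
        using cx[OF v] by (simp add: distrib_left mult.assoc)
      also have "\<dots> \<le> C * ?gn r v + 1/2 * ?gn 0 v"
        using half by (intro add_left_mono mult_right_mono) auto
      finally have "?gn 0 v \<le> 2 * (C * ?gn r v)" by argo
      then show ?thesis by (simp only: mult.assoc)
    qed
    then have "\<forall>r\<in>{a..b} \<inter> {0..T}. \<forall>v\<in>D. ?gn 0 v \<le> (2 * C) * ?gn r v"
      if "a \<le> x \<and> x \<le> b \<and> b - a < d" for a b
      using that by auto
    moreover have "2 * C \<ge> 0" using C by simp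
    ultimately show "\<exists>d>0. \<forall>a b. a \<le> x \<and> x \<le> b \<and> b - a < d \<longrightarrow>
        (\<exists>C\<ge>0. \<forall>r\<in>{a..b} \<inter> {0..T}. \<forall>v\<in>D. ?gn 0 v \<le> C * ?gn r v)"
      using d by blast
  qed
  then obtain C where C: "C \<ge> 0" "\<And>r v. r \<in> {0..T} \<Longrightarrow> v \<in> D \<Longrightarrow> ?gn 0 v \<le> C * ?gn r v" by auto
  show thesis
  proof
    show "0 \<le> K1 * C" using K1 C by simp
    fix a b r v assume *: "a \<in> {0..T}" "b \<in> {0..T}" "r \<in> {0..T}" "v \<in> D"
    have "norm (g a v - g b v) \<le> K1 * \<bar>a - b\<bar> * ?gn 0 v"
      using * by (intro lip0)
    also have "\<dots> \<le> K1 * \<bar>a - b\<bar> * (C * ?gn r v)"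
      using K1 C * by (intro mult_left_mono) auto
    finally show "norm (g a v - g b v) \<le> K1 * C * \<bar>a - b\<bar> * ?gn r v" by (simp add: mult_ac)
  qed
qed

section \<open>Frozen semigroups and backward transport on a compact interval\<close>

text \<open>Kato class data on \<open>{0..T}\<close> with constants independent of time:
  \<open>\<mu>\<close> and \<open>\<nu>\<close> compare \<open>N t\<close> with the original norm,
  and \<open>\<kappa>\<close> is a Lipschitz constant for both the norms and the operators.
  \<open>S t\<close> is the semigroup of the operator frozen at \<open>t\<close>. The graph norm in
  \<open>G_lipschitz\<close> may be taken at any third time \<open>r\<close>.\<close>

locale kato_interval =
  fixes G :: "real \<Rightarrow> ('x::{real_inner, banach} \<times> 'x) set" and D :: "'x set"
    and N :: "real \<Rightarrow> 'x \<Rightarrow> real" and S :: "real \<Rightarrow> real \<Rightarrow> 'x \<Rightarrow> 'x"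
    and T \<mu> \<nu> \<kappa> :: real
  assumes const_signs: "\<mu> > 0" "\<nu> \<ge> 0" "\<kappa> \<ge> 0"
    and dom: "\<And>t. t \<in> {0..T} \<Longrightarrow> Domain (G t) = D"
    and semigroup: "\<And>t. t \<in> {0..T} \<Longrightarrow> C0_semigroup (S t)"
    and gen: "\<And>t. t \<in> {0..T} \<Longrightarrow> G t = generator (S t)"
    and contractive: "\<And>t h v. t \<in> {0..T} \<Longrightarrow> h \<ge> 0 \<Longrightarrow> N t (S t h v) \<le> N t v"
    and triangle: "\<And>t u v. t \<in> {0..T} \<Longrightarrow> N t (u + v) \<le> N t u + N t v"
    and lower: "\<And>t v. t \<in> {0..T} \<Longrightarrow> \<mu> * norm v \<le> N t v"
    and upper: "\<And>t v. t \<in> {0..T} \<Longrightarrow> N t v \<le> \<nu> * norm v"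
    and N_lipschitz: "\<And>a b v. a \<in> {0..T} \<Longrightarrow> b \<in> {0..T} \<Longrightarrow> N a v \<le> (1 + \<kappa> * \<bar>a - b\<bar>) * N b v"
    and G_lipschitz: "\<And>a b r v va vb z. a \<in> {0..T} \<Longrightarrow> b \<in> {0..T} \<Longrightarrow> r \<in> {0..T} \<Longrightarrow>
        (v, va) \<in> G a \<Longrightarrow> (v, vb) \<in> G b \<Longrightarrow> (v, z) \<in> G r \<Longrightarrow>
        norm (va - vb) \<le> \<kappa> * \<bar>a - b\<bar> * (norm v + norm z)"
begin

lemma N_nonneg: "t \<in> {0..T} \<Longrightarrow> N t v \<ge> 0"
  using lower[of t v] const_signs by (meson mult_nonneg_nonneg norm_ge_zero less_imp_le order_trans)

lemma graph_norm_le: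
  assumes "t \<in> {0..T}"
  shows "norm v + norm z \<le> (N t v + N t z) / \<mu>"
  using lower[OF assms, of v] lower[OF assms, of z] const_signs by (simp add: field_simps)

text \<open>Exponential growth rate of the graph norm built from \<open>N t\<close>: the first
  summand pays for changing the norm, the second for changing the operator.\<close>

definition \<rho> where "\<rho> = \<kappa> + \<nu> * \<kappa> / \<mu>"

lemma \<rho>_nonneg: "\<rho> \<ge> 0"
  using const_signs by (simp add: \<rho>_def)

text \<open>First the operator is exchanged while the norm \<open>N b\<close> is kept, then the norm
  is exchanged. Bounding each factor \<open>1 + x\<close> by \<open>exp x\<close> gives a form that
  multiplies along a grid to a bound free of the number of steps.\<close>

lemma graph_norm_change:
  assumes ab: "a \<in> {0..T}" "b \<in> {0..T}" and G: "(v, z') \<in> G a" "(v, z) \<in> G b"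
  shows "N a v + N a z' \<le> exp (\<rho> * \<bar>a - b\<bar>) * (N b v + N b z)"
proof -
  define d where "d = \<bar>a - b\<bar>"
  define M where "M = N b v + N b z"
  have d: "d \<ge> 0" and M: "M \<ge> 0"
    using N_nonneg[OF ab(2)] by (auto simp: d_def M_def)
  have "N b z' \<le> N b z + N b (z' - z)"
    using triangle[OF ab(2), of z "z' - z"] by simp
  also have "N b (z' - z) \<le> \<nu> * norm (z' - z)"
    by (rule upper[OF ab(2)])
  also have "\<dots> \<le> \<nu> * (\<kappa> * d * (norm v + norm z))"
    using const_signs G_lipschitz[OF ab ab(2) G G(2)] by (intro mult_left_mono) (auto simp: d_def)
  also have "\<dots> \<le> \<nu> * (\<kappa> * d * (M / \<mu>))"
    unfolding M_def using const_signs d graph_norm_le[OF ab(2)] by (intro mult_left_mono) auto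
  finally have "N b v + N b z' \<le> M + \<nu> * (\<kappa> * d * (M / \<mu>))"
    by (simp add: M_def)
  also have "\<dots> = (1 + \<nu> * \<kappa> / \<mu> * d) * M" by (simp add: field_simps)
  finally have 1: "N b v + N b z' \<le> (1 + \<nu> * \<kappa> / \<mu> * d) * M" .
  have "N a v + N a z' \<le> (1 + \<kappa> * d) * N b v + (1 + \<kappa> * d) * N b z'"
    unfolding d_def by (intro add_mono N_lipschitz ab)
  also have "\<dots> = (1 + \<kappa> * d) * (N b v + N b z')" by (simp add: distrib_left)
  also have "\<dots> \<le> (1 + \<kappa> * d) * ((1 + \<nu> * \<kappa> / \<mu> * d) * M)"
    using const_signs d by (intro mult_left_mono 1) auto
  also have "\<dots> \<le> exp (\<kappa> * d) * (exp (\<nu> * \<kappa> / \<mu> * d) * M)"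
    using const_signs d M by (intro mult_mono exp_ge_add_one_self mult_nonneg_nonneg add_nonneg_nonneg divide_nonneg_nonneg) auto
  also have "\<dots> = exp (\<rho> * d) * M"
  proof -
    have "exp (\<kappa> * d) * exp (\<nu> * \<kappa> / \<mu> * d) = exp (\<rho> * d)"
      by (simp add: \<rho>_def exp_add distrib_right)
    then show ?thesis by (metis mult.assoc)
  qed
  finally show ?thesis by (simp add: d_def M_def)
qed

lemma semigroup_bound:
  assumes "t \<in> {0..T}" "h \<ge> 0"
  shows "norm (S t h v) \<le> \<nu> / \<mu> * norm v"
proof -
  have "\<mu> * norm (S t h v) \<le> \<nu> * norm v"
    using lower[OF assms(1), of "S t h v"] contractive[OF assms, of v] upper[OF assms(1), of v]
    by linarith
  then show ?thesis using const_signs by (simp add: field_simps)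
qed

lemma graph_norm_contractive:
  assumes "t \<in> {0..T}" "h \<ge> 0"
  shows "N t (S t h y) + N t (S t h z) \<le> N t y + N t z"
  using contractive[OF assms] by (intro add_mono)

text \<open>The adjoint problem is frozen at the right end point: \<open>r \<mapsto> S b (b - r) y\<close> solves it
  backwards in time, so the pairing with \<open>w\<close> is constant up to the variation of \<open>G\<close>.\<close>

lemma frozen_step:
  assumes ab: "0 \<le> a" "a \<le> b" "b \<le> T" and y: "(y, z) \<in> G b"
    and w: "continuous_on {a..b} w"
    and w': "\<And>r. r \<in> {a<..<b} \<Longrightarrow> (w has_vector_derivative w' r) (at r)"
    and dual: "\<And>r v z. r \<in> {a<..<b} \<Longrightarrow> (v, z) \<in> G r \<Longrightarrow> inner (w' r) v = inner (w r) z"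
    and W: "\<And>r. r \<in> {a..b} \<Longrightarrow> norm (w r) \<le> W"
  obtains v z' where "(v, z') \<in> G a"
    "N a v + N a z' \<le> exp (\<rho> * (b - a)) * (N b y + N b z)"
    "\<bar>inner (w b) y - inner (w a) v\<bar> \<le> W * \<kappa> / \<mu> * (b - a)\<^sup>2 * (N b y + N b z)"
proof -
  have a: "a \<in> {0..T}" and b: "b \<in> {0..T}" using ab by auto
  define v where "v r = S b (b - r) y" for r
  define zv where "zv r = S b (b - r) z" for r
  have v_dom: "(v r, zv r) \<in> G b" if "r \<le> b" for r
    using generator_invariant[OF semigroup[OF b]] y that by (simp add: gen[OF b] v_def zv_def)
  have v_end: "v b = y"
    using semigroup[OF b] by (simp add: v_def C0_semigroup_def)
  obtain z' where z': "(v a, z') \<in> G a"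
    using v_dom[of a] dom[OF a] dom[OF b] ab by blast
  have bound: "N b (v r) + N b (zv r) \<le> N b y + N b z" if "r \<le> b" for r
    using that unfolding v_def zv_def by (intro graph_norm_contractive[OF b]) simp
  have 1: "N a (v a) + N a z' \<le> exp (\<rho> * (b - a)) * (N b y + N b z)"
  proof -
    have "N a (v a) + N a z' \<le> exp (\<rho> * \<bar>a - b\<bar>) * (N b (v a) + N b (zv a))"
      by (rule graph_norm_change[OF a b z' v_dom]) (use ab in simp)
    also have "\<dots> \<le> exp (\<rho> * \<bar>a - b\<bar>) * (N b y + N b z)"
      using ab by (intro mult_left_mono bound) auto
    finally show ?thesis using ab by simp
  qed
  have 2: "\<bar>inner (w b) y - inner (w a) (v a)\<bar> \<le> W * \<kappa> / \<mu> * (b - a)\<^sup>2 * (N b y + N b z)"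
  proof (cases "a = b")
    case True
    then show ?thesis using v_end by simp
  next
    case False
    with ab have "a < b" by simp
    define \<phi> where "\<phi> r = inner (w r) (v r)" for r
    have cont_v: "continuous_on {a..b} v"
    proof -
      have "continuous_on {0..} (\<lambda>h. S b h y)"
        using semigroup[OF b] by (simp add: C0_semigroup_def)
      then show ?thesis
        unfolding v_def by (rule continuous_on_compose2) (auto intro!: continuous_intros)
    qed
    have dv: "(v has_vector_derivative - zv r) (at r)" if "r < b" for r
    proof -
      have "((\<lambda>h. S b h y) has_vector_derivative zv r) (at (b - r))"
        unfolding zv_def
      proof (rule C0_semigroup_has_vector_derivative[OF semigroup[OF b]])
        show "(y, z) \<in> generator (S b)" using y by (simp add: gen[OF b])
        show "norm (S b h x) \<le> \<nu> / \<mu> * norm x" if "h \<ge> 0" for h x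
          by (rule semigroup_bound[OF b that])
      qed (use that in simp)
      moreover have "((\<lambda>r. b - r) has_vector_derivative - 1) (at r)"
        by (auto intro!: derivative_eq_intros)
      ultimately have "((\<lambda>h. S b h y) \<circ> (\<lambda>r. b - r) has_vector_derivative (- 1) *\<^sub>R zv r) (at r)"
        by (intro vector_diff_chain_at)
      then show ?thesis by (simp add: o_def v_def[abs_def])
    qed
    \<comment> \<open>Mean value theorem for the pairing \<open>\<phi>\<close>; the term with
      \<open>zv\<close> carries a minus sign because \<open>v\<close> runs backwards in
      time.\<close>
    have "\<exists>\<xi>\<in>{a<..<b}. \<phi> b - \<phi> a = (b - a) * (inner (w' \<xi>) (v \<xi>) - inner (w \<xi>) (zv \<xi>))"
    proof -
      have "continuous_on {a..b} \<phi>"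
        unfolding \<phi>_def by (intro continuous_intros w cont_v)
      moreover have "\<And>r. a < r \<Longrightarrow> r < b \<Longrightarrow> (\<phi> has_derivative
          (\<lambda>h. h * (inner (w' r) (v r) - inner (w r) (zv r)))) (at r)"
      proof -
        fix r assume "a < r" "r < b"
        then have "(\<phi> has_derivative (\<lambda>h. inner (w r) (h *\<^sub>R (- zv r)) + inner (h *\<^sub>R w' r) (v r))) (at r)"
          unfolding \<phi>_def using w'[of r] dv[of r]
          by (intro has_derivative_inner) (auto simp: has_vector_derivative_def)
        then show "(\<phi> has_derivative (\<lambda>h. h * (inner (w' r) (v r) - inner (w r) (zv r)))) (at r)"
          by (rule has_derivative_eq_rhs) (auto simp: algebra_simps)
      qed
      ultimately show ?thesis
        by (rule mvt[OF \<open>a < b\<close>]) (assumption+, rule bexI, assumption, simp)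
    qed
    then obtain \<xi> where \<xi>: "\<xi> \<in> {a<..<b}"
      and diff: "\<phi> b - \<phi> a = (b - a) * (inner (w' \<xi>) (v \<xi>) - inner (w \<xi>) (zv \<xi>))" by blast
    have \<xi>T: "\<xi> \<in> {0..T}" using \<xi> ab by auto
    \<comment> \<open>As \<open>v \<xi>\<close> lies in the common domain, the operator at time
      \<open>\<xi>\<close> applies to it too. Duality replaces the term with \<open>w' \<xi>\<close>
      by one with \<open>q\<close>, and \<open>q - zv \<xi>\<close> is only of order
      \<open>b - a\<close>; with the factor from the mean value theorem the change is
      quadratic.\<close>
    obtain q where q: "(v \<xi>, q) \<in> G \<xi>"
      using v_dom[of \<xi>] dom[OF \<xi>T] dom[OF b] \<xi> by fastforce
    have W0: "W \<ge> 0"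
      using W[of a] ab by (meson atLeastAtMost_iff norm_ge_zero order_refl order_trans)
    have "norm (q - zv \<xi>) \<le> \<kappa> * \<bar>\<xi> - b\<bar> * (norm (v \<xi>) + norm (zv \<xi>))"
      using \<xi> by (intro G_lipschitz[OF \<xi>T b b q] v_dom) auto
    also have "\<dots> \<le> \<kappa> * (b - a) * ((N b y + N b z) / \<mu>)"
    proof (intro mult_mono)
      have "norm (v \<xi>) + norm (zv \<xi>) \<le> (N b (v \<xi>) + N b (zv \<xi>)) / \<mu>"
        by (rule graph_norm_le[OF b])
      also have "\<dots> \<le> (N b y + N b z) / \<mu>"
        using bound[of \<xi>] \<xi> const_signs by (intro divide_right_mono) auto
      finally show "norm (v \<xi>) + norm (zv \<xi>) \<le> (N b y + N b z) / \<mu>" .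
    qed (use \<xi> const_signs ab in auto)
    finally have qz: "norm (q - zv \<xi>) \<le> \<kappa> * (b - a) * ((N b y + N b z) / \<mu>)" .
    have "\<phi> b - \<phi> a = (b - a) * inner (w \<xi>) (q - zv \<xi>)"
      using diff dual[OF \<xi> q] by (simp add: inner_diff_right)
    then have "\<bar>\<phi> b - \<phi> a\<bar> = (b - a) * \<bar>inner (w \<xi>) (q - zv \<xi>)\<bar>"
      using ab by (simp add: abs_mult)
    also have "\<dots> \<le> (b - a) * (norm (w \<xi>) * norm (q - zv \<xi>))"
      using ab by (intro mult_left_mono Cauchy_Schwarz_ineq2) auto
    also have "\<dots> \<le> (b - a) * (W * (\<kappa> * (b - a) * ((N b y + N b z) / \<mu>)))"
      using ab W[of \<xi>] \<xi> W0 by (intro mult_left_mono mult_mono qz) auto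
    finally show ?thesis
      using v_end by (simp add: \<phi>_def power2_eq_square field_simps)
  qed
  show thesis by (rule that[OF z' 1 2])
qed

text \<open>Induction on the number of cells. The last cell is treated first, and the vector it
  produces at its left end is the datum for the remaining ones. Growth factors multiply to
  \<open>exp (\<rho> * (n * h))\<close>, while the errors of order \<open>h^2\<close> add
  up.\<close>

lemma frozen_steps:
  assumes "0 \<le> a" "h \<ge> 0" "a + real n * h \<le> B" "B \<le> T" and "(y, z) \<in> G (a + real n * h)"
    and w: "continuous_on {a..B} w"
    and w': "\<And>r. r \<in> {a<..<B} \<Longrightarrow> (w has_vector_derivative w' r) (at r)"
    and dual: "\<And>r v z. r \<in> {a<..<B} \<Longrightarrow> (v, z) \<in> G r \<Longrightarrow> inner (w' r) v = inner (w r) z"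
    and W: "\<And>r. r \<in> {a..B} \<Longrightarrow> norm (w r) \<le> W"
  shows "\<exists>v z'. (v, z') \<in> G a \<and>
    N a v + N a z' \<le> exp (\<rho> * (n * h)) * (N (a + n * h) y + N (a + n * h) z) \<and>
    \<bar>inner (w (a + n * h)) y - inner (w a) v\<bar>
      \<le> n * (W * \<kappa> / \<mu> * h\<^sup>2) * (exp (\<rho> * (n * h)) * (N (a + n * h) y + N (a + n * h) z))"
  using assms(3,5)
proof (induction n arbitrary: y z)
  case 0
  then show ?case by (intro exI[of _ y] exI[of _ z]) simp
next
  case (Suc n)
  define b where "b = a + real n * h"
  have b': "a + real (Suc n) * h = b + h" by (simp add: b_def distrib_right)
  have b: "0 \<le> b" "a \<le> b" "b \<le> b + h" "b + h \<le> B"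
    using assms(1,2) Suc.prems(1) unfolding b' by (auto simp: b_def)
  define M where "M = N (b + h) y + N (b + h) z"
  have M: "M \<ge> 0" unfolding M_def using b assms(4) by (intro add_nonneg_nonneg N_nonneg) auto
  define Q where "Q = W * \<kappa> / \<mu> * h\<^sup>2"
  have "W \<ge> 0"
    using W[of a] b by (meson atLeastAtMost_iff norm_ge_zero order_refl order_trans)
  then have Q: "Q \<ge> 0" using const_signs by (simp add: Q_def)
  obtain v1 z1 where v1: "(v1, z1) \<in> G b"
    "N b v1 + N b z1 \<le> exp (\<rho> * h) * M"
    "\<bar>inner (w (b + h)) y - inner (w b) v1\<bar> \<le> Q * M"
  proof (rule frozen_step[of b "b + h" y z w w' W])
    show "continuous_on {b..b + h} w"
      by (rule continuous_on_subset[OF w]) (use b in auto)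
    show "(y, z) \<in> G (b + h)" using Suc.prems(2) by (simp only: b')
  qed (use b assms(4) w' dual W in \<open>auto simp: M_def Q_def\<close>)
  obtain v z' where v: "(v, z') \<in> G a"
    "N a v + N a z' \<le> exp (\<rho> * (n * h)) * (N b v1 + N b z1)"
    "\<bar>inner (w b) v1 - inner (w a) v\<bar> \<le> n * Q * (exp (\<rho> * (n * h)) * (N b v1 + N b z1))"
    using Suc.IH[of v1 z1] v1(1) b unfolding b_def[symmetric] Q_def by auto
  have E: "exp (\<rho> * (n * h)) * (N b v1 + N b z1) \<le> exp (\<rho> * (real (Suc n) * h)) * M"
  proof -
    have "exp (\<rho> * (n * h)) * (N b v1 + N b z1) \<le> exp (\<rho> * (n * h)) * (exp (\<rho> * h) * M)"
      by (intro mult_left_mono v1) simp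
    then show ?thesis by (simp add: exp_add distrib_left distrib_right mult_ac)
  qed
  have "\<bar>inner (w (b + h)) y - inner (w a) v\<bar>
      \<le> \<bar>inner (w (b + h)) y - inner (w b) v1\<bar> + \<bar>inner (w b) v1 - inner (w a) v\<bar>"
    by simp
  also have "\<dots> \<le> Q * M + n * Q * (exp (\<rho> * (real (Suc n) * h)) * M)"
    using v1(3) v(3) mult_left_mono[OF E, of "n * Q"] Q by simp
  \<comment> \<open>The error of the last cell is enlarged by an exponential at least 1, so that it
    has the same shape as the other \<open>n\<close> errors.\<close>
  also have "Q * M \<le> Q * (exp (\<rho> * (real (Suc n) * h)) * M)"
  proof -
    have "1 \<le> exp (\<rho> * (real (Suc n) * h))"
      using \<rho>_nonneg assms(2) by (simp del: of_nat_Suc)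
    then have "1 * M \<le> exp (\<rho> * (real (Suc n) * h)) * M"
      using M by (rule mult_right_mono)
    then show ?thesis using Q by (intro mult_left_mono) simp_all
  qed
  finally have close: "\<bar>inner (w (b + h)) y - inner (w a) v\<bar>
      \<le> real (Suc n) * Q * (exp (\<rho> * (real (Suc n) * h)) * M)"
    by (simp add: algebra_simps)
  show ?case
    unfolding b'
  proof (intro exI conjI)
    show "(v, z') \<in> G a" by (rule v(1))
    show "N a v + N a z' \<le> exp (\<rho> * (real (Suc n) * h)) * (N (b + h) y + N (b + h) z)"
      using order_trans[OF v(2) E] unfolding M_def .
    show "\<bar>inner (w (b + h)) y - inner (w a) v\<bar> \<le> real (Suc n) * (W * \<kappa> / \<mu> * h\<^sup>2) *
        (exp (\<rho> * (real (Suc n) * h)) * (N (b + h) y + N (b + h) z))"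
      using close unfolding M_def Q_def .
  qed
qed

text \<open>Refining the grid removes the error: with \<open>Suc n\<close> cells the total is of
  order \<open>1 / Suc n\<close>. In the limit only the bound \<open>L\<close> at the left end point
  remains, multiplied by the growth of the transported graph norm; \<open>\<nu>\<close> and
  \<open>\<mu>\<close> convert between \<open>N\<close> and the original norm.\<close>

lemma adjoint_estimate:
  assumes ab: "0 \<le> a" "a \<le> b" "b \<le> T" and y: "(y, z) \<in> G b"
    and w: "continuous_on {a..b} w"
    and w': "\<And>r. r \<in> {a<..<b} \<Longrightarrow> (w has_vector_derivative w' r) (at r)"
    and dual: "\<And>r v z. r \<in> {a<..<b} \<Longrightarrow> (v, z) \<in> G r \<Longrightarrow> inner (w' r) v = inner (w r) z"
    and L: "L \<ge> 0" "\<And>v z. (v, z) \<in> G a \<Longrightarrow> \<bar>inner (w a) v\<bar> \<le> L * (norm v + norm z)"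
  shows "\<bar>inner (w b) y\<bar> \<le> exp (\<rho> * (b - a)) * \<nu> / \<mu> * L * (norm y + norm z)"
proof -
  have a: "a \<in> {0..T}" and b: "b \<in> {0..T}" using ab by auto
  have "compact (w ` {a..b})" using w by (intro compact_continuous_image compact_Icc)
  then obtain W where W: "\<And>r. r \<in> {a..b} \<Longrightarrow> norm (w r) \<le> W"
    using compact_imp_bounded bounded_iff by (metis imageI)
  \<comment> \<open>Bound on the graph norm of the vector transported from \<open>b\<close> to
    \<open>a\<close>, the same for every grid.\<close>
  define EM where "EM = exp (\<rho> * (b - a)) * (N b y + N b z)"
  \<comment> \<open>For mesh \<open>h = (b - a) / Suc n\<close>, the sum of \<open>Suc n\<close>
    errors proportional to \<open>h^2\<close> is proportional to
    \<open>(b - a)^2 / Suc n\<close>.\<close>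
  have "\<bar>inner (w b) y\<bar> \<le> L / \<mu> * EM + W * \<kappa> / \<mu> * (b - a)\<^sup>2 * EM * (1 / real (Suc n))" for n
  proof -
    define h where "h = (b - a) / real (Suc n)"
    have nh: "real (Suc n) * h = b - a" by (simp add: h_def)
    have b_eq: "a + (b - a) = b" by simp
    have "\<exists>v z'. (v, z') \<in> G a \<and> N a v + N a z' \<le> EM \<and>
      \<bar>inner (w b) y - inner (w a) v\<bar> \<le> real (Suc n) * (W * \<kappa> / \<mu> * h\<^sup>2) * EM"
      unfolding EM_def
    proof (rule frozen_steps[of a h "Suc n" b y z w w' W, unfolded nh b_eq])
      show "0 \<le> h" using ab by (simp add: h_def)
    qed (fact ab y w w' dual W order_refl)+
    then obtain v z' where v: "(v, z') \<in> G a" "N a v + N a z' \<le> EM"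
      "\<bar>inner (w b) y - inner (w a) v\<bar> \<le> real (Suc n) * (W * \<kappa> / \<mu> * h\<^sup>2) * EM" by blast
    have "\<bar>inner (w a) v\<bar> \<le> L * (norm v + norm z')" by (rule L(2)[OF v(1)])
    also have "\<dots> \<le> L * ((N a v + N a z') / \<mu>)"
      using L(1) graph_norm_le[OF a] by (rule mult_left_mono[rotated])
    also have "\<dots> \<le> L * (EM / \<mu>)"
      using L(1) v(2) const_signs by (intro mult_left_mono divide_right_mono) auto
    finally have "\<bar>inner (w a) v\<bar> \<le> L / \<mu> * EM" by simp
    moreover have "real (Suc n) * (W * \<kappa> / \<mu> * h\<^sup>2) * EM = W * \<kappa> / \<mu> * (b - a)\<^sup>2 * EM * (1 / real (Suc n))"
      unfolding h_def by (simp add: power2_eq_square del: of_nat_Suc)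
    ultimately show ?thesis using v(3) by linarith
  qed
  moreover have "(\<lambda>n. L / \<mu> * EM + W * \<kappa> / \<mu> * (b - a)\<^sup>2 * EM * (1 / real (Suc n)))
      \<longlonglongrightarrow> L / \<mu> * EM + W * \<kappa> / \<mu> * (b - a)\<^sup>2 * EM * 0"
    by (intro tendsto_intros LIMSEQ_Suc lim_1_over_n)
  ultimately have "\<bar>inner (w b) y\<bar> \<le> L / \<mu> * EM + W * \<kappa> / \<mu> * (b - a)\<^sup>2 * EM * 0"
    by (intro LIMSEQ_le_const) auto
  also have "\<dots> \<le> L / \<mu> * (exp (\<rho> * (b - a)) * (\<nu> * (norm y + norm z)))"
  proof -
    have "EM \<le> exp (\<rho> * (b - a)) * (\<nu> * (norm y + norm z))"
      unfolding EM_def using upper[OF b, of y] upper[OF b, of z]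
      by (intro mult_left_mono) (auto simp: distrib_left)
    then have "L / \<mu> * EM \<le> L / \<mu> * (exp (\<rho> * (b - a)) * (\<nu> * (norm y + norm z)))"
      using L(1) const_signs by (intro mult_left_mono) auto
    then show ?thesis by simp
  qed
  finally show ?thesis by (simp add: mult_ac)
qed

end

text \<open>Uniform constants come from two sources. The Lipschitz condition compares each
  \<open>N t\<close> with \<open>N 0\<close> up to the factor \<open>1 + c * T\<close>, so the
  equivalence constants of \<open>N 0\<close> serve for all times. Since \<open>G 0\<close> is a
  closed subspace, \<open>graph_norm_lipschitz\<close> applies to the operators.\<close>

lemma kato_class_interval:
  fixes G :: "real \<Rightarrow> ('x::{real_inner, banach} \<times> 'x) set"
  assumes kato: "kato_class G" and sub: "\<And>t. t \<ge> 0 \<Longrightarrow> subspace (G t)"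
    and closed: "\<And>t. t \<ge> 0 \<Longrightarrow> closed (G t)" and T: "T \<ge> 0"
  shows "\<exists>D N S \<mu> \<nu> \<kappa>. kato_interval G D N S T \<mu> \<nu> \<kappa>"
proof -
  from kato have stable: "kato_stable G" and "\<exists>D. (\<forall>t\<ge>0. Domain (G t) = D) \<and>
      (\<forall>t\<ge>0. \<forall>s\<ge>0. \<exists>c. \<forall>x\<in>D.
        norm (op_app (G t) x) \<le> c * (norm x + norm (op_app (G s) x))) \<and>
      (\<forall>x\<in>D. \<exists>g'. continuous_on {0..} g' \<and>
        (\<forall>t\<ge>0. ((\<lambda>t. op_app (G t) x) has_vector_derivative g' t) (at t within {0..})))"
    unfolding kato_class_def by (rule conjunct1, rule conjunct2)
  from this(2) obtain D where D_all: "(\<forall>t\<ge>0. Domain (G t) = D) \<and>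
      (\<forall>t\<ge>0. \<forall>s\<ge>0. \<exists>c. \<forall>x\<in>D.
        norm (op_app (G t) x) \<le> c * (norm x + norm (op_app (G s) x))) \<and>
      (\<forall>x\<in>D. \<exists>g'. continuous_on {0..} g' \<and>
        (\<forall>t\<ge>0. ((\<lambda>t. op_app (G t) x) has_vector_derivative g' t) (at t within {0..})))" ..
  have D: "Domain (G t) = D" if "t \<ge> 0" for t
    using D_all that by simp
  have equiv: "\<exists>c. \<forall>x\<in>D. norm (op_app (G t) x) \<le> c * (norm x + norm (op_app (G s) x))"
    if "t \<ge> 0" "s \<ge> 0" for t s
    using D_all that by simp
  have C1: "\<exists>g'. continuous_on {0..} g' \<and>
      (\<forall>t\<ge>0. ((\<lambda>t. op_app (G t) x) has_vector_derivative g' t) (at t within {0..}))"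
    if "x \<in> D" for x
    using D_all that by simp
  from stable obtain N where N_all: "(\<forall>t\<ge>0. equivalent_norm (N t)) \<and>
      (\<forall>T\<ge>0. \<exists>c\<ge>0. \<forall>x. \<forall>t\<in>{0..T}. \<forall>s\<in>{0..T}.
        \<bar>N t x - N s x\<bar> \<le> c * \<bar>t - s\<bar> * N s x) \<and>
      (\<forall>t\<ge>0. generates_contractive_C0_semigroup (N t) (G t))"
    unfolding kato_stable_def ..
  have N: "equivalent_norm (N t)" if "t \<ge> 0" for t
    using N_all that by simp
  have N_lip: "\<exists>c\<ge>0. \<forall>x. \<forall>t\<in>{0..T}. \<forall>s\<in>{0..T}. \<bar>N t x - N s x\<bar> \<le> c * \<bar>t - s\<bar> * N s x"
    using N_all T by simp
  have N_gen: "generates_contractive_C0_semigroup (N t) (G t)" if "t \<ge> 0" for t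
    using N_all that by simp
  have "\<forall>t. \<exists>S. t \<ge> 0 \<longrightarrow> C0_semigroup S \<and> G t = generator S \<and> (\<forall>h\<ge>0. \<forall>x. N t (S h x) \<le> N t x)"
    using N_gen unfolding generates_contractive_C0_semigroup_def by blast
  from choice[OF this] obtain S where S_all: "\<forall>t. t \<ge> 0 \<longrightarrow> C0_semigroup (S t) \<and>
      G t = generator (S t) \<and> (\<forall>h\<ge>0. \<forall>x. N t (S t h x) \<le> N t x)" ..
  have S: "C0_semigroup (S t)" "G t = generator (S t)" "h \<ge> 0 \<Longrightarrow> N t (S t h x) \<le> N t x"
    if "t \<ge> 0" for t h x
    using S_all that by simp_all
  have app: "op_app (G t) v = z" if t: "t \<ge> 0" and z: "(v, z) \<in> G t" for t v z
    unfolding op_app_def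
  proof (rule the_equality[of "\<lambda>y. (v, y) \<in> G t", OF z])
    fix y assume "(v, y) \<in> G t"
    then show "y = z" using z unfolding S(2)[OF t] by (rule generator_unique)
  qed
  have app_mem: "(v, op_app (G t) v) \<in> G t" if "t \<ge> 0" "v \<in> D" for t v
    using that D app by blast
  have graph: "(\<lambda>v. (v, op_app (G 0) v)) ` D = G 0"
    using app[of 0] app_mem[of 0] D[of 0] by (auto simp: image_iff)
  obtain K where K: "K \<ge> 0" "\<And>a b r v. a \<in> {0..T} \<Longrightarrow> b \<in> {0..T} \<Longrightarrow> r \<in> {0..T} \<Longrightarrow> v \<in> D \<Longrightarrow>
      norm (op_app (G a) v - op_app (G b) v) \<le> K * \<bar>a - b\<bar> * (norm v + norm (op_app (G r) v))"
  proof (rule graph_norm_lipschitz[of D "\<lambda>t. op_app (G t)" T])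
    fix t :: real and u v assume t: "t \<ge> 0" and "u \<in> D" "v \<in> D"
    then have "(u, op_app (G t) u) + (v, op_app (G t) v) \<in> G t"
      by (intro subspace_add sub app_mem)
    then show "op_app (G t) (u + v) = op_app (G t) u + op_app (G t) v"
      using app[OF t] by simp
  next
    fix t a :: real and v assume t: "t \<ge> 0" and "v \<in> D"
    then have "a *\<^sub>R (v, op_app (G t) v) \<in> G t"
      by (intro subspace_scale sub app_mem)
    then show "op_app (G t) (a *\<^sub>R v) = a *\<^sub>R op_app (G t) v"
      using app[OF t] by simp
  qed (use sub[of 0] closed[of 0] equiv C1 T in \<open>auto simp: graph\<close>)
  obtain c where c: "c \<ge> 0" "\<And>x t s. t \<in> {0..T} \<Longrightarrow> s \<in> {0..T} \<Longrightarrow>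
      \<bar>N t x - N s x\<bar> \<le> c * \<bar>t - s\<bar> * N s x"
    using N_lip by blast
  obtain m M where mM: "m > 0" "M > 0" "\<And>x. m * norm x \<le> N 0 x" "\<And>x. N 0 x \<le> M * norm x"
    using N[of 0] unfolding equivalent_norm_def by auto
  have N_nonneg: "N t x \<ge> 0" if t: "t \<ge> 0" for t x
  proof -
    obtain d where "d > 0" "d * norm x \<le> N t x"
      using N[OF t] unfolding equivalent_norm_def by blast
    then show ?thesis by (meson mult_nonneg_nonneg norm_ge_zero less_imp_le order_trans)
  qed
  have lip: "N a x \<le> (1 + c * \<bar>a - b\<bar>) * N b x" if "a \<in> {0..T}" "b \<in> {0..T}" for a b x
    using c(2)[OF that, of x] by (simp add: distrib_right)
  have lipT: "N a x \<le> (1 + c * T) * N b x" if "a \<in> {0..T}" "b \<in> {0..T}" for a b x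
  proof -
    have "c * \<bar>a - b\<bar> \<le> c * T" using that c(1) by (intro mult_left_mono) auto
    then have "(1 + c * \<bar>a - b\<bar>) * N b x \<le> (1 + c * T) * N b x"
      using that N_nonneg[of b x] by (intro mult_right_mono) auto
    then show ?thesis using lip[OF that, of x] by linarith
  qed
  have cT: "1 + c * T > 0" using c T by (simp add: add_pos_nonneg)
  \<comment> \<open>\<open>m\<close> and \<open>M\<close> are the equivalence constants of
    \<open>N 0\<close>; \<open>c\<close> and \<open>K\<close> are the Lipschitz constants of the
    norms and of the operators.\<close>
  have "kato_interval G D N S T (m / (1 + c * T)) ((1 + c * T) * M) (max c K)"
  proof (unfold_locales, goal_cases)
    case 1
    show ?case using mM cT by simp
  next
    case 2
    show ?case using mM cT by simp
  next
    case 3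
    show ?case using c by simp
  next
    case (8 t u v)
    then show ?case using N[of t] by (simp add: equivalent_norm_def)
  next
    case (9 t v)
    have "m * norm v \<le> (1 + c * T) * N t v"
      using mM(3)[of v] lipT[of 0 t v] 9 T by auto
    then show ?case using cT by (simp add: field_simps)
  next
    case (10 t v)
    have "N t v \<le> (1 + c * T) * N 0 v" using 10 T by (intro lipT) auto
    also have "\<dots> \<le> (1 + c * T) * (M * norm v)" using cT mM by (intro mult_left_mono) auto
    finally show ?case by (simp add: mult.assoc)
  next
    case (11 a b v)
    have "c * \<bar>a - b\<bar> \<le> max c K * \<bar>a - b\<bar>" by (intro mult_right_mono) auto
    then have "(1 + c * \<bar>a - b\<bar>) * N b v \<le> (1 + max c K * \<bar>a - b\<bar>) * N b v"
      using 11 N_nonneg[of b v] by (intro mult_right_mono) auto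
    then show ?case using lip[OF 11(1,2), of v] by linarith
  next
    case (12 a b r v va vb z)
    then have "v \<in> D" using D[of a] by auto
    then have "norm (va - vb) \<le> K * \<bar>a - b\<bar> * (norm v + norm z)"
      using K(2)[of a b r v] 12 app[of a v va] app[of b v vb] app[of r v z] by auto
    also have "\<dots> \<le> max c K * \<bar>a - b\<bar> * (norm v + norm z)"
      by (intro mult_right_mono) auto
    finally show ?case .
  qed (use D S in auto)
  then show ?thesis by blast
qed

section \<open>Extrapolation and mild solutions\<close>

lemma op_adjointD: "(x, w) \<in> A \<Longrightarrow> (v, z) \<in> op_adjoint A \<Longrightarrow> inner w v = inner x z"
  unfolding op_adjoint_def by auto

lemma extrapolation_space_bounded_linear:
  assumes "extrapolation_space \<iota> A"
  shows "bounded_linear \<iota>"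
proof -
  obtain \<beta> R C where lin: "linear \<iota>" and R: "is_resolvent A \<beta> R"
    and C: "C > 0" "\<And>x. norm (\<iota> x) \<le> C * norm (R x)"
    using assms unfolding extrapolation_space_def by blast
  have bl: "bounded_linear R" using R by (simp add: is_resolvent_def)
  have "norm (\<iota> x) \<le> norm x * (C * onorm R)" for x
  proof -
    have "C * norm (R x) \<le> C * (onorm R * norm x)"
      using C by (intro mult_left_mono onorm[OF bl]) auto
    then show ?thesis using C(2)[of x] by (simp add: mult_ac)
  qed
  then show ?thesis
    by (intro bounded_linear_intro[of \<iota>]) (auto simp: linear_add[OF lin] linear_scale[OF lin])
qed

text \<open>If \<open>\<iota> x\<close> vanishes then so does \<open>R x\<close>, which puts
  \<open>(0, - x)\<close> into the graph of \<open>A\<close>; a linear operator sends 0 only to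
  0.\<close>

lemma extrapolation_space_inj:
  assumes "extrapolation_space \<iota> A" and A: "linear_operator A"
  shows "inj \<iota>"
proof -
  obtain \<beta> R c where lin: "linear \<iota>" and R: "is_resolvent A \<beta> R"
    and c: "c > 0" "\<And>x. c * norm (R x) \<le> norm (\<iota> x)"
    using assms(1) unfolding extrapolation_space_def by blast
  have "x = 0" if "\<iota> x = 0" for x
  proof -
    have "R x = 0" using c(1) c(2)[of x] that by (simp add: mult_le_0_iff)
    then have "(0, - x) \<in> A" using R unfolding is_resolvent_def
      by (metis diff_0 scaleR_zero_right)
    moreover have "(0, 0) \<in> A"
      using A subspace_0[of A] by (simp add: linear_operator_def zero_prod_def)
    ultimately show "x = 0"
      using A unfolding linear_operator_def single_valued_def by (metis neg_equal_0_iff_equal)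
  qed
  then show ?thesis using linear_injective_0[OF lin] by blast
qed

text \<open>The pairing of \<open>x\<close> with \<open>v\<close> equals that of \<open>R x\<close>
  with \<open>\<beta> v - z\<close>, and \<open>norm (R x)\<close> is bounded by a multiple of
  \<open>norm (\<iota> x)\<close>.\<close>

lemma extrapolation_norm_dual_upper:
  fixes A :: "('x::{real_inner, banach} \<times> 'x) set"
  assumes "extrapolation_space \<iota> A"
  obtains C where "C \<ge> 0"
    "\<And>x v z. (v, z) \<in> op_adjoint A \<Longrightarrow> \<bar>inner x v\<bar> \<le> C * norm (\<iota> x) * (norm v + norm z)"
proof -
  obtain \<beta> R c where R: "is_resolvent A \<beta> R"
    and c: "c > 0" "\<And>x. c * norm (R x) \<le> norm (\<iota> x)"
    using assms(1) unfolding extrapolation_space_def by blast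
  show thesis
  proof
    show "(\<bar>\<beta>\<bar> + 1) / c \<ge> 0" using c by simp
    fix x v z assume vz: "(v, z) \<in> op_adjoint A"
    have "(R x, \<beta> *\<^sub>R R x - x) \<in> A" using R by (simp add: is_resolvent_def)
    then have "inner x v = inner (R x) (\<beta> *\<^sub>R v - z)"
      using op_adjointD[OF _ vz] by (fastforce simp: inner_diff)
    then have "\<bar>inner x v\<bar> \<le> norm (R x) * norm (\<beta> *\<^sub>R v - z)"
      by (simp add: Cauchy_Schwarz_ineq2)
    also have "\<dots> \<le> (norm (\<iota> x) / c) * ((\<bar>\<beta>\<bar> + 1) * (norm v + norm z))"
    proof (intro mult_mono)
      show "norm (R x) \<le> norm (\<iota> x) / c" using c by (simp add: pos_le_divide_eq mult.commute)
      have "norm (\<beta> *\<^sub>R v - z) \<le> \<bar>\<beta>\<bar> * norm v + norm z"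
        using norm_triangle_ineq4[of "\<beta> *\<^sub>R v" z] by simp
      also have "\<dots> \<le> (\<bar>\<beta>\<bar> + 1) * (norm v + norm z)"
        by (simp add: algebra_simps)
      finally show "norm (\<beta> *\<^sub>R v - z) \<le> (\<bar>\<beta>\<bar> + 1) * (norm v + norm z)" .
    qed (use c in auto)
    finally show "\<bar>inner x v\<bar> \<le> (\<bar>\<beta>\<bar> + 1) / c * norm (\<iota> x) * (norm v + norm z)"
      by (simp add: mult_ac)
  qed
qed

text \<open>Test with \<open>v\<close> equal to the adjoint of \<open>R\<close> applied to
  \<open>R x\<close>: the pairing with \<open>x\<close> is then \<open>(norm (R x))^2\<close>, while
  the graph norm of \<open>v\<close> is at most a multiple, \<open>E\<close>, of
  \<open>norm (R x)\<close>.\<close>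

lemma extrapolation_norm_dual_lower:
  fixes A :: "('x::{real_inner, banach} \<times> 'x) set"
  assumes "extrapolation_space \<iota> A"
  obtains C where "C \<ge> 0" "\<And>x K. K \<ge> 0 \<Longrightarrow>
    (\<And>v z. (v, z) \<in> op_adjoint A \<Longrightarrow> \<bar>inner x v\<bar> \<le> K * (norm v + norm z)) \<Longrightarrow> norm (\<iota> x) \<le> C * K"
proof -
  obtain \<beta> R C where R: "is_resolvent A \<beta> R"
    and C: "C > 0" "\<And>x. norm (\<iota> x) \<le> C * norm (R x)"
    using assms(1) unfolding extrapolation_space_def by blast
  have bl: "bounded_linear R" using R by (simp add: is_resolvent_def)
  define E where "E = onorm R * (1 + \<bar>\<beta>\<bar>) + 1"
  have E: "E \<ge> 0" using onorm_pos_le[OF bl] by (simp add: E_def)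
  show thesis
  proof
    show "C * E \<ge> 0" using C E by simp
    fix x K assume K: "K \<ge> 0"
      and bound: "\<And>v z. (v, z) \<in> op_adjoint A \<Longrightarrow> \<bar>inner x v\<bar> \<le> K * (norm v + norm z)"
    define q where "q = R x"
    obtain y where y: "(y, \<beta> *\<^sub>R y - q) \<in> op_adjoint A" "\<And>x. inner (R x) q = inner x y"
      "norm y \<le> onorm R * norm q"
      using adjoint_resolvent[OF R] by blast
    have "norm y + norm (\<beta> *\<^sub>R y - q) \<le> (1 + \<bar>\<beta>\<bar>) * norm y + norm q"
      using norm_triangle_ineq4[of "\<beta> *\<^sub>R y" q] by (simp add: algebra_simps)
    also have "\<dots> \<le> (1 + \<bar>\<beta>\<bar>) * (onorm R * norm q) + norm q"
      by (intro add_right_mono mult_left_mono y) auto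
    also have "\<dots> = E * norm q" by (simp add: E_def algebra_simps)
    finally have gy: "norm y + norm (\<beta> *\<^sub>R y - q) \<le> E * norm q" .
    have "norm q * norm q = inner x y"
      using y(2)[of x] by (simp add: q_def dot_square_norm power2_eq_square)
    also have "\<dots> \<le> K * (norm y + norm (\<beta> *\<^sub>R y - q))"
      using bound[OF y(1)] by linarith
    also have "\<dots> \<le> K * (E * norm q)" using K gy by (rule mult_left_mono[rotated])
    finally have "norm q * norm q \<le> (E * K) * norm q" by (simp add: mult_ac)
    then have "norm q \<le> E * K"
      using E K by (cases "q = 0") auto
    then have "C * norm q \<le> C * (E * K)" using C by (intro mult_left_mono) auto
    then show "norm (\<iota> x) \<le> C * E * K" using C(2)[of x] by (simp add: q_def mult.assoc)
  qed
qed

section \<open>Extending the evolution family to the extrapolation space\<close>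

text \<open>\<open>adjoint_estimate\<close> is placed between the two duality bounds: the upper one
  at time \<open>s\<close> supplies \<open>L\<close>, the lower one at time \<open>t\<close> turns
  the resulting functional bound back into a norm. This works for \<open>x\<close> in the dense
  space of classical initial values and passes to all \<open>x\<close> by continuity.\<close>

lemma evolution_family_extrapolation_bound:
  fixes A :: "real \<Rightarrow> ('x::{real_inner, banach} \<times> 'x) set"
  assumes extrapolation: "common_extrapolation_space \<iota> A"
    and evolution: "generates_evolution_family A U"
    and kato: "kato_class (\<lambda>t. op_adjoint (A t))"
    and st: "0 \<le> s" "s \<le> t"
  obtains C where "\<And>x. norm (\<iota> (U t s x)) \<le> C * norm (\<iota> x)"
proof -
  have es: "extrapolation_space \<iota> (A s)" and et: "extrapolation_space \<iota> (A t)"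
    using extrapolation st by (auto simp: common_extrapolation_space_def)
  obtain C1 where C1: "C1 \<ge> 0" "\<And>x v z. (v, z) \<in> op_adjoint (A s) \<Longrightarrow>
      \<bar>inner x v\<bar> \<le> C1 * norm (\<iota> x) * (norm v + norm z)"
    using extrapolation_norm_dual_upper[OF es] by metis
  obtain C2 where C2: "C2 \<ge> 0" "\<And>x K. K \<ge> 0 \<Longrightarrow>
      (\<And>v z. (v, z) \<in> op_adjoint (A t) \<Longrightarrow> \<bar>inner x v\<bar> \<le> K * (norm v + norm z)) \<Longrightarrow>
      norm (\<iota> x) \<le> C2 * K"
    using extrapolation_norm_dual_lower[OF et] by metis
  have "t \<ge> 0" using st by simp
  then obtain D N S \<mu> \<nu> \<kappa> where "kato_interval (\<lambda>t. op_adjoint (A t)) D N S t \<mu> \<nu> \<kappa>"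
    using kato_class_interval[OF kato op_adjoint_subspace op_adjoint_closed] by blast
  then interpret kato_interval "\<lambda>t. op_adjoint (A t)" D N S t \<mu> \<nu> \<kappa> .
  define C3 where "C3 = exp (\<rho> * (t - s)) * \<nu> / \<mu>"
  have C3: "C3 \<ge> 0" using const_signs by (simp add: C3_def)
  obtain Y where Y: "closure Y = UNIV" "\<And>x. x \<in> Y \<Longrightarrow> classical_solution A s x (\<lambda>t. U t s x)"
    using evolution st(1) unfolding generates_evolution_family_def by metis
  have dense: "norm (\<iota> (U t s x)) \<le> C2 * C3 * C1 * norm (\<iota> x)" if x: "x \<in> Y" for x
  proof -
    obtain w' where sol: "continuous_on {s..} (\<lambda>t. U t s x)" "U s s x = x"
      "\<And>r. r > s \<Longrightarrow> ((\<lambda>t. U t s x) has_vector_derivative w' r) (at r)"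
      "\<And>r. r > s \<Longrightarrow> (U r s x, w' r) \<in> A r"
      using Y(2)[OF x] unfolding classical_solution_def by metis
    have "norm (\<iota> (U t s x)) \<le> C2 * (C3 * (C1 * norm (\<iota> x)))"
    proof (rule C2(2))
      show "0 \<le> C3 * (C1 * norm (\<iota> x))" using C1 C3 by simp
      fix v z assume vz: "(v, z) \<in> op_adjoint (A t)"
      show "\<bar>inner (U t s x) v\<bar> \<le> C3 * (C1 * norm (\<iota> x)) * (norm v + norm z)"
        unfolding C3_def mult.assoc[symmetric] times_divide_eq_left
      proof (rule adjoint_estimate[of s t v z "\<lambda>r. U r s x" w' "C1 * norm (\<iota> x)",
            unfolded mult.assoc[symmetric] times_divide_eq_left])
        show "continuous_on {s..t} (\<lambda>r. U r s x)"
          by (rule continuous_on_subset[OF sol(1)]) auto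
        show "inner (w' r) v = inner (U r s x) z" if "r \<in> {s<..<t}" "(v, z) \<in> op_adjoint (A r)" for r v z
          using op_adjointD[OF sol(4) that(2)] that(1) by simp
        show "\<bar>inner (U s s x) v\<bar> \<le> C1 * norm (\<iota> x) * (norm v + norm z)"
          if "(v, z) \<in> op_adjoint (A s)" for v z
          using C1(2)[OF that] sol(2) by simp
      qed (use st vz sol(3) C1 in auto)
    qed
    then show ?thesis by (simp add: mult.assoc)
  qed
  have "bounded_linear (U t s)"
    using evolution st by (auto simp: generates_evolution_family_def evolution_family_def)
  then have "continuous_on UNIV (U t s)" "continuous_on UNIV \<iota>"
    using extrapolation_space_bounded_linear[OF es]
    by (auto intro: linear_continuous_on)
  then have "continuous_on UNIV (\<lambda>x. norm (\<iota> (U t s x)))" "continuous_on UNIV (\<lambda>x. C2 * C3 * C1 * norm (\<iota> x))"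
    by (auto intro!: continuous_intros continuous_on_compose2[of UNIV \<iota>])
  then have "closed {x. norm (\<iota> (U t s x)) \<le> C2 * C3 * C1 * norm (\<iota> x)}"
    by (rule closed_Collect_le)
  then have "closure Y \<subseteq> {x. norm (\<iota> (U t s x)) \<le> C2 * C3 * C1 * norm (\<iota> x)}"
    using dense by (intro closure_minimal) auto
  then show thesis using that Y(1) by blast
qed

text \<open>Extension of a Lipschitz map from a dense subspace. Uniqueness, linearity and the norm
  bound are closed conditions, so each needs checking only on the range of
  \<open>\<iota>\<close>.\<close>

lemma ex1_extension:
  fixes \<iota> :: "'x::real_normed_vector \<Rightarrow> 'e::banach"
  assumes \<iota>: "linear \<iota>" "inj \<iota>" "closure (range \<iota>) = UNIV" and V: "linear V"
    and bound: "\<And>x. norm (\<iota> (V x)) \<le> C * norm (\<iota> x)"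
  shows "\<exists>!V1. is_extension \<iota> V V1"
proof (rule ex_ex1I)
  have dense: "e \<in> S" if "closed S" "range \<iota> \<subseteq> S" for e and S :: "'e set"
    using closure_minimal[OF that(2,1)] \<iota>(3) by blast
  {
    fix V1 V2 assume "is_extension \<iota> V V1" "is_extension \<iota> V V2"
    then have "closed {e. V1 e = V2 e}" "range \<iota> \<subseteq> {e. V1 e = V2 e}"
      by (auto simp: is_extension_def intro!: closed_Collect_eq linear_continuous_on)
    then show "V1 = V2" using dense by blast
  }
  define f where "f e = \<iota> (V (inv \<iota> e))" for e
  have f: "f (\<iota> x) = \<iota> (V x)" for x using \<iota>(2) by (simp add: f_def)
  have "uniformly_continuous_on (range \<iota>) f"
  proof (rule lipschitz_on_uniformly_continuous, rule lipschitz_onI)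
    fix p q assume "p \<in> range \<iota>" "q \<in> range \<iota>"
    then obtain x y where p: "p = \<iota> x" "q = \<iota> y" by blast
    have "f p - f q = \<iota> (V (x - y))" "p - q = \<iota> (x - y)"
      using \<iota>(1) V by (simp_all add: p f linear_diff)
    then have "dist (f p) (f q) \<le> C * dist p q"
      using bound[of "x - y"] by (simp add: dist_norm)
    also have "\<dots> \<le> \<bar>C\<bar> * dist p q" by (intro mult_right_mono) auto
    finally show "dist (f p) (f q) \<le> \<bar>C\<bar> * dist p q" .
  qed simp
  then obtain g where "uniformly_continuous_on UNIV g" and fg: "\<And>e. e \<in> range \<iota> \<Longrightarrow> f e = g e"
    using uniformly_continuous_on_extension_on_closure[of "range \<iota>" f] \<iota>(3) by metis
  then have cont: "continuous_on UNIV g" by (simp add: uniformly_continuous_imp_continuous)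
  have contI: "continuous_on UNIV h \<Longrightarrow> continuous_on UNIV (\<lambda>e. g (h e))" for h :: "'e \<Rightarrow> 'e"
    by (rule continuous_on_compose2[OF cont]) auto
  have g: "g (\<iota> x) = \<iota> (V x)" for x using f fg by simp
  \<comment> \<open>Additivity is extended one argument at a time: here the first argument stays in
    the range of \<open>\<iota>\<close>, next the second is fixed and the first varies.\<close>
  have add1: "g (\<iota> x + e) = g (\<iota> x) + g e" for x e
  proof -
    have "closed {e. g (\<iota> x + e) = g (\<iota> x) + g e}"
      by (intro closed_Collect_eq contI continuous_intros cont)
    moreover have "range \<iota> \<subseteq> {e. g (\<iota> x + e) = g (\<iota> x) + g e}"
    proof safe
      fix y
      have "g (\<iota> x + \<iota> y) = g (\<iota> (x + y))" by (simp only: linear_add[OF \<iota>(1)])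
      also have "\<dots> = g (\<iota> x) + g (\<iota> y)"
        by (simp only: g) (simp only: linear_add[OF V] linear_add[OF \<iota>(1)])
      finally show "g (\<iota> x + \<iota> y) = g (\<iota> x) + g (\<iota> y)" .
    qed
    ultimately show ?thesis using dense by blast
  qed
  have add: "g (e' + e) = g e' + g e" for e' e
  proof -
    have "closed {e'. g (e' + e) = g e' + g e}"
      by (intro closed_Collect_eq contI continuous_intros cont)
    moreover have "range \<iota> \<subseteq> {e'. g (e' + e) = g e' + g e}"
      using add1 by auto
    ultimately show ?thesis using dense by blast
  qed
  have scale: "g (a *\<^sub>R e) = a *\<^sub>R g e" for a e
  proof -
    have "closed {e. g (a *\<^sub>R e) = a *\<^sub>R g e}"
      by (intro closed_Collect_eq contI continuous_intros cont)
    moreover have "range \<iota> \<subseteq> {e. g (a *\<^sub>R e) = a *\<^sub>R g e}"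
    proof safe
      fix x
      have "g (a *\<^sub>R \<iota> x) = g (\<iota> (a *\<^sub>R x))" by (simp only: linear_scale[OF \<iota>(1)])
      also have "\<dots> = a *\<^sub>R g (\<iota> x)"
        by (simp only: g) (simp only: linear_scale[OF V] linear_scale[OF \<iota>(1)])
      finally show "g (a *\<^sub>R \<iota> x) = a *\<^sub>R g (\<iota> x)" .
    qed
    ultimately show ?thesis using dense by blast
  qed
  have "norm (g e) \<le> norm e * C" for e
  proof -
    have "closed {e. norm (g e) \<le> norm e * C}"
      by (intro closed_Collect_le continuous_intros cont)
    moreover have "range \<iota> \<subseteq> {e. norm (g e) \<le> norm e * C}"
      using bound g by (auto simp: mult.commute)
    ultimately show ?thesis using dense by blast
  qed
  then have "bounded_linear g"
    using add scale by (intro bounded_linear_intro)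
  then show "\<exists>V1. is_extension \<iota> V V1"
    using g by (auto simp: is_extension_def)
qed

section \<open>Continuity of the input term\<close>

text \<open>Near \<open>t1\<close>, \<open>z\<close> is compared with the continuous orbit through
  \<open>z t0\<close> for one \<open>t0\<close> just before \<open>t1\<close>. The primitive of
  \<open>g\<close> is continuous, so the defect is uniformly small on a neighbourhood of
  \<open>t1\<close>.\<close>

lemma continuous_on_local_evolution:
  fixes z :: "real \<Rightarrow> 'x::real_normed_vector" and g :: "real \<Rightarrow> real"
  assumes U: "evolution_family U" and s: "s \<ge> 0"
    and g: "\<And>T. T \<ge> 0 \<Longrightarrow> g integrable_on {0..T}"
    and step: "\<And>T. T > 0 \<Longrightarrow> \<exists>c>0. \<forall>t0 t. s \<le> t0 \<and> t0 \<le> t \<and> t \<le> T \<longrightarrow>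
      (norm (z t - U t t0 (z t0)))\<^sup>2 \<le> c * integral {t0..t} g"
  shows "continuous_on {s..} z"
  unfolding continuous_on_iff
proof (intro ballI allI impI)
  fix t1 e :: real assume t1: "t1 \<in> {s..}" and e: "e > 0"
  define T where "T = t1 + 1"
  have T: "T > 0" using t1 s by (simp add: T_def)
  obtain c where c: "c > 0" "\<And>t0 t. s \<le> t0 \<Longrightarrow> t0 \<le> t \<Longrightarrow> t \<le> T \<Longrightarrow>
      (norm (z t - U t t0 (z t0)))\<^sup>2 \<le> c * integral {t0..t} g"
    using step[OF T] by blast
  define F where "F t = integral {0..t} g" for t
  define \<eta> where "\<eta> = (e / 3)\<^sup>2 / c"
  have \<eta>: "\<eta> > 0" using e c by (simp add: \<eta>_def)
  have "continuous_on {0..T} F"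
    unfolding F_def using T by (intro indefinite_integral_continuous_1 g) simp
  moreover have "t1 \<in> {0..T}" using t1 s by (simp add: T_def)
  ultimately obtain \<delta> where \<delta>: "\<delta> > 0"
    "\<And>t. t \<in> {0..T} \<Longrightarrow> dist t t1 < \<delta> \<Longrightarrow> dist (F t) (F t1) < \<eta> / 2"
    unfolding continuous_on_iff using \<eta> by (meson half_gt_zero)
  \<comment> \<open>Starting half of \<open>\<delta>\<close> before \<open>t1\<close> lets a single
    orbit cover times on both sides of \<open>t1\<close>; the maximum keeps the start within
    \<open>{s..}\<close>.\<close>
  define t0 where "t0 = max s (t1 - \<delta> / 2)"
  have t0: "s \<le> t0" "t0 \<le> t1" "0 \<le> t0" "dist t0 t1 < \<delta>"
    using t1 s \<delta>(1) by (auto simp: t0_def dist_real_def)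
  have near: "norm (z t - U t t0 (z t0)) < e / 3" if t: "t0 \<le> t" "t \<le> T" "dist t t1 < \<delta>" for t
  proof -
    have "g integrable_on {0..t}" using t t0 by (intro g) simp
    then have "F t - F t0 = integral {t0..t} g"
      unfolding F_def using Henstock_Kurzweil_Integration.integral_combine[of 0 t0 t g] t t0 by simp
    moreover have "dist (F t) (F t1) < \<eta> / 2" "dist (F t0) (F t1) < \<eta> / 2"
      using t t0 t1 s by (intro \<delta>(2); auto simp: T_def)+
    ultimately have "integral {t0..t} g < \<eta>"
      unfolding dist_real_def by linarith
    then have "c * integral {t0..t} g < c * \<eta>" using c by simp
    then have "(norm (z t - U t t0 (z t0)))\<^sup>2 < (e / 3)\<^sup>2"
      using c(1) c(2)[OF t0(1) t(1,2)] by (simp add: \<eta>_def)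
    then show ?thesis by (rule power_less_imp_less_base) (use e in simp)
  qed
  have "continuous_on {t0..} (\<lambda>t. U t t0 (z t0))"
  proof -
    have "continuous_on {(t, s). 0 \<le> s \<and> s \<le> t} (\<lambda>(t, s). U t s (z t0))"
      using U by (simp add: evolution_family_def)
    then have "continuous_on {t0..} (\<lambda>t. (\<lambda>(t, s). U t s (z t0)) (t, t0))"
      by (rule continuous_on_compose2) (use t0 in \<open>auto intro!: continuous_intros\<close>)
    then show ?thesis by simp
  qed
  then have "\<forall>\<epsilon>>0. \<exists>d>0. \<forall>t\<in>{t0..}. dist t t1 < d \<longrightarrow> dist (U t t0 (z t0)) (U t1 t0 (z t0)) < \<epsilon>"
    using t0(2) by (simp add: continuous_on_iff)
  moreover have "e / 3 > 0" using e by simp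
  ultimately obtain \<delta>' where \<delta>': "\<delta>' > 0" "\<And>t. t \<ge> t0 \<Longrightarrow> dist t t1 < \<delta>' \<Longrightarrow>
      dist (U t t0 (z t0)) (U t1 t0 (z t0)) < e / 3" by (meson atLeast_iff)
  show "\<exists>d>0. \<forall>t\<in>{s..}. dist t t1 < d \<longrightarrow> dist (z t) (z t1) < e"
  \<comment> \<open>\<open>\<delta> / 2\<close> keeps \<open>t\<close> to the right of
    \<open>t0\<close> and the defect small, \<open>\<delta>'\<close> controls the orbit through
    \<open>z t0\<close>, and 1 keeps \<open>t\<close> below \<open>T = t1 + 1\<close>.\<close>
  proof (intro exI[of _ "min (min (\<delta> / 2) \<delta>') 1"] conjI ballI impI)
    fix t assume t: "t \<in> {s..}" "dist t t1 < min (min (\<delta> / 2) \<delta>') 1"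
    have "\<bar>t - t1\<bar> < \<delta> / 2" "\<bar>t - t1\<bar> < 1" using t(2) by (simp_all add: dist_real_def)
    then have "t1 - \<delta> / 2 \<le> t" "t \<le> T" "dist t t1 < \<delta>"
      unfolding T_def dist_real_def using \<delta>(1) by linarith+
    then have in_range: "t \<ge> t0" "t \<le> T" "dist t t1 < \<delta>"
      using t(1) by (simp_all add: t0_def)
    have 1: "dist (z t) (U t t0 (z t0)) < e / 3"
      unfolding dist_norm by (rule near[OF in_range])
    have 2: "dist (z t1) (U t1 t0 (z t0)) < e / 3"
      unfolding dist_norm by (rule near) (use t0 \<delta>(1) in \<open>auto simp: T_def\<close>)
    have 3: "dist (U t t0 (z t0)) (U t1 t0 (z t0)) < e / 3"
      using t in_range by (intro \<delta>') auto
    have "dist (z t) (z t1) \<le> dist (z t) (U t t0 (z t0))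
        + (dist (U t t0 (z t0)) (U t1 t0 (z t0)) + dist (z t1) (U t1 t0 (z t0)))"
      using dist_triangle[of "z t" "z t1" "U t t0 (z t0)"]
        dist_triangle2[of "U t t0 (z t0)" "z t1" "U t1 t0 (z t0)"] by linarith
    then show "dist (z t) (z t1) < e" using 1 2 3 by linarith
  qed (use \<delta> \<delta>' in simp)
qed

theorem proposition5p3:
  fixes \<AA> :: "real \<Rightarrow> ('x::{real_inner, banach} \<times> 'x) set"
    and \<BB> :: "real \<Rightarrow> ('x \<times> 'u::{real_inner, banach}) set"
    and \<CC> :: "real \<Rightarrow> ('x \<times> 'y::{real_inner, banach}) set"
    and A :: "real \<Rightarrow> ('x \<times> 'x) set"
    and \<iota> :: "'x \<Rightarrow> 'e::banach"
    and U :: "real \<Rightarrow> real \<Rightarrow> 'x \<Rightarrow> 'x"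
    and B :: "real \<Rightarrow> 'u \<Rightarrow> 'e"
  assumes nbco: "nbco_system \<AA> \<BB> \<CC>"
    and main: "\<And>t. t \<ge> 0 \<Longrightarrow> A t = main_operator (\<AA> t) (\<BB> t)"
    and extrapolation: "common_extrapolation_space \<iota> A"
    and evolution: "generates_evolution_family A U"
    and control: "\<And>t. t \<ge> 0 \<Longrightarrow> is_control_operator \<iota> (\<AA> t) (\<BB> t) (B t)"
    and kato: "kato_class (\<lambda>t. op_adjoint (A t))"
    and admissible: "L2_admissible \<iota> U B"
  shows "\<forall>s\<ge>0. \<forall>xs u. L2_loc u \<and> L1_loc (\<lambda>r. B r (u r)) \<longrightarrow>
           (\<exists>x. mild_solution \<iota> U B s xs u x \<and>
                (\<forall>x'. mild_solution \<iota> U B s xs u x' \<longrightarrow> (\<forall>t\<ge>s. x' t = x t)))"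
proof (intro allI impI)
  fix s :: real and xs :: 'x and u :: "real \<Rightarrow> 'u"
  assume s: "s \<ge> 0" and "L2_loc u \<and> L1_loc (\<lambda>r. B r (u r))"
  then have u: "L2_loc u" by simp
  have U: "evolution_family U" and A0: "linear_operator (A 0)"
    using evolution by (auto simp: generates_evolution_family_def)
  have e0: "extrapolation_space \<iota> (A 0)"
    using extrapolation by (simp add: common_extrapolation_space_def)
  then have dense: "closure (range \<iota>) = UNIV" by (simp add: extrapolation_space_def)
  have inj: "inj \<iota>" by (rule extrapolation_space_inj[OF e0 A0])
  have lin: "linear \<iota>" using e0 by (simp add: extrapolation_space_def)
  have blU: "bounded_linear (U t r)" if "0 \<le> r" "r \<le> t" for t r
    using U that by (simp add: evolution_family_def)
  have ex1: "\<exists>!V1. is_extension \<iota> (U t r) V1" if rt: "0 \<le> r" "r \<le> t" for t r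
  proof -
    obtain C where C: "\<And>x. norm (\<iota> (U t r x)) \<le> C * norm (\<iota> x)"
      using evolution_family_extrapolation_bound[OF extrapolation evolution kato rt] by blast
    show ?thesis
      by (rule ex1_extension[OF lin inj dense bounded_linear.linear[OF blU[OF rt]] C])
  qed
  define W where "W t r = extension \<iota> (U t r)" for t r
  have W: "is_extension \<iota> (U t r) (W t r)" if "0 \<le> r" "r \<le> t" for t r
    unfolding W_def extension_def by (rule theI'[OF ex1[OF that]])
  have W_bl: "bounded_linear (W t r)" and W_ext: "W t r (\<iota> x) = \<iota> (U t r x)"
    if "0 \<le> r" "r \<le> t" for t r x
    using W[OF that] by (auto simp: is_extension_def)
  \<comment> \<open>The composition of two extensions extends the composition of the evolution
    operators, so uniqueness transfers the evolution law to the extrapolation space.\<close>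
  have W_comp: "W t r e = W t p (W p r e)" if "0 \<le> r" "r \<le> p" "p \<le> t" for t p r e
  proof -
    have "U t r x = U t p (U p r x)" for x
      using U that by (simp add: evolution_family_def)
    then have "is_extension \<iota> (U t r) (\<lambda>e. W t p (W p r e))"
      using that W_ext bounded_linear_compose[OF W_bl[of p t] W_bl[of r p]]
      by (simp add: is_extension_def)
    moreover have "is_extension \<iota> (U t r) (W t r)" using that by (intro W) auto
    moreover have "\<exists>!V1. is_extension \<iota> (U t r) V1" using that by (intro ex1) auto
    ultimately have "W t r = (\<lambda>e. W t p (W p r e))" by (metis (no_types))
    then show ?thesis by metis
  qed
  have integrable: "bochner_integrable_on (\<lambda>r. W t r (B r (u r))) {0..t}" if "t \<ge> 0" for t
    using admissible u that unfolding L2_admissible_def W_def by blast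
  have in_X: "input_term \<iota> U B u t r \<in> range \<iota>" if "0 \<le> r" "r \<le> t" for t r
    using admissible u that unfolding L2_admissible_def by blast
  have estimate: "\<exists>c>0. \<forall>r t z. 0 \<le> r \<and> r \<le> t \<and> t \<le> T \<and> \<iota> z = input_term \<iota> U B u t r \<longrightarrow>
      (norm z)\<^sup>2 \<le> c * integral {r..t} (\<lambda>r. (norm (u r))\<^sup>2)" if "T > 0" for T
    using admissible u that unfolding L2_admissible_def by meson
  \<comment> \<open>Splitting at \<open>p\<close>, the kernel on the earlier part factors through
    \<open>W t p\<close>, a bounded operator that can be pulled out of the integral.\<close>
  have input_split: "input_term \<iota> U B u t r = W t p (input_term \<iota> U B u p r) + input_term \<iota> U B u t p"
    if "0 \<le> r" "r \<le> p" "p \<le> t" for t p r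
  proof -
    let ?f = "\<lambda>t r. W t r (B r (u r))"
    have int: "?f t integrable_on {r..t}" if "0 \<le> r" "r \<le> t" for t r
      by (rule integrable_on_subinterval[OF bochner_integrable_imp_integrable[OF integrable]])
         (use that in auto)
    have "integral {r..t} (?f t) = integral {r..p} (?f t) + integral {p..t} (?f t)"
      using that int[of r t] by (simp add: Henstock_Kurzweil_Integration.integral_combine)
    also have "integral {r..p} (?f t) = integral {r..p} (W t p \<circ> ?f p)"
    proof (rule integral_cong)
      show "?f t q = (W t p \<circ> ?f p) q" if "q \<in> {r..p}" for q
        using W_comp[of q p t "B q (u q)"] that \<open>0 \<le> r\<close> \<open>p \<le> t\<close> by simp
    qed
    also have "\<dots> = W t p (integral {r..p} (?f p))"
      using that by (intro integral_linear int W_bl) auto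
    finally show ?thesis by (simp add: input_term_def W_def)
  qed
  define z where "z t = inv \<iota> (input_term \<iota> U B u t s)" for t
  have z: "\<iota> (z t) = input_term \<iota> U B u t s" if "t \<ge> s" for t
    unfolding z_def using in_X[OF s that] by (rule f_inv_into_f)
  \<comment> \<open>Admissibility bounds preimages in \<open>X\<close> of input terms. This
    identifies the preimage for the interval from \<open>p\<close> to \<open>t\<close> as the defect
    of \<open>z\<close> from the evolution started at \<open>z p\<close>.\<close>
  have z_split: "input_term \<iota> U B u t p = \<iota> (z t - U t p (z p))" if "s \<le> p" "p \<le> t" for t p
  proof -
    have "\<iota> (z t) = W t p (\<iota> (z p)) + input_term \<iota> U B u t p"
      using input_split[of s p t] z s that by simp
    also have "W t p (\<iota> (z p)) = \<iota> (U t p (z p))"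
      using s that by (intro W_ext) auto
    finally show ?thesis by (simp add: linear_diff[OF lin])
  qed
  have cont_z: "continuous_on {s..} z"
  proof (rule continuous_on_local_evolution[OF U s])
    show "(\<lambda>r. (norm (u r))\<^sup>2) integrable_on {0..T}" if "T \<ge> 0" for T
      using u that by (auto simp: L2_loc_def absolutely_integrable_on_def)
    show "\<exists>c>0. \<forall>p t. s \<le> p \<and> p \<le> t \<and> t \<le> T \<longrightarrow>
        (norm (z t - U t p (z p)))\<^sup>2 \<le> c * integral {p..t} (\<lambda>r. (norm (u r))\<^sup>2)" if "T > 0" for T
    proof -
      obtain c where "c > 0" and c: "\<And>p t z. 0 \<le> p \<Longrightarrow> p \<le> t \<Longrightarrow> t \<le> T \<Longrightarrow>
          \<iota> z = input_term \<iota> U B u t p \<Longrightarrow> (norm z)\<^sup>2 \<le> c * integral {p..t} (\<lambda>r. (norm (u r))\<^sup>2)"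
        using estimate[OF \<open>T > 0\<close>] by blast
      then show ?thesis using s z_split by (intro exI[of _ c]) auto
    qed
  qed
  have cont_U: "continuous_on {s..} (\<lambda>t. U t s xs)"
  proof -
    have "continuous_on {(t, s). 0 \<le> s \<and> s \<le> t} (\<lambda>(t, s). U t s xs)"
      using U by (simp add: evolution_family_def)
    then have "continuous_on {s..} (\<lambda>t. (\<lambda>(t, s). U t s xs) (t, s))"
      by (rule continuous_on_compose2) (use s in \<open>auto intro!: continuous_intros\<close>)
    then show ?thesis by simp
  qed
  define x where "x t = U t s xs + z t" for t
  have "mild_solution \<iota> U B s xs u x"
    unfolding mild_solution_def mild_solution_extrapolated_def
    using ex1 integrable in_X z cont_z cont_U
    by (auto simp: x_def[abs_def] W_def linear_add[OF lin] intro!: continuous_intros)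
  \<comment> \<open>The mild solution formula fixes the image under \<open>\<iota>\<close> of any
    solution, and \<open>\<iota>\<close> is injective.\<close>
  moreover have "x' t = x t" if "mild_solution \<iota> U B s xs u x'" "t \<ge> s" for x' t
  proof (rule injD[OF inj])
    show "\<iota> (x' t) = \<iota> (x t)"
      using that z[OF that(2)]
      by (simp add: mild_solution_def mild_solution_extrapolated_def x_def linear_add[OF lin])
  qed
  ultimately show "\<exists>x. mild_solution \<iota> U B s xs u x \<and>
      (\<forall>x'. mild_solution \<iota> U B s xs u x' \<longrightarrow> (\<forall>t\<ge>s. x' t = x t))" by blast
qed

end
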